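(* Let $\gamma$ be an oval, let $F$ be its outer length billiard map, and fix an origin $O$ in the interior of $\gamma$. In polar coordinates $(\alpha,r)$ centered at $O$, consider the vector field $$X=-\frac{2w(\alpha)}{r}\,\frac{\partial}{\partial\alpha}$$ on $\mathbb{R}^2\setminus\{O\}$, and let $\Phi$ be its time-$1$ flow. Then there is a constant $C$, depending only on $\gamma$ and $O$, such that for every point $x$ in the exterior of $\gamma$, $$|F^2(x)-\Phi(x)|\le \frac{C}{|x|},$$ where $|x|$ denotes the distance from $x$ to $O$.
   Context: An oval is a smooth closed simple planar curve $\gamma$ with everywhere positive curvature; it bounds a compact strictly convex domain $K$. Orient $\gamma$ counterclockwise. For a point $A\in\mathbb{R}^2\setminus K$ there are exactly two lines through $A$ tangent to $\gamma$. The positive tangency point $x_+(A)$ is the one for which $x_+(A)-A$ is a positive multiple of the oriented tangent vector of $\gamma$ at $x_+(A)$. The negative tangency point $x_-(A)$ is the one for which $A-x_-(A)$ is a positive multiple of the oriented tangent vector of $\gamma$ at $x_-(A)$. Outer length billiard map $F:\mathbb{R}^2\setminus K\to\mathbb{R}^2\setminus K$. Let $\Sigma_A$ be the circle that is inscribed in the angle with vertex $A$ formed by the ray from $A$ through $x_+(A)$ and the ray from $A$ opposite to the ray from $A$ through $x_-(A)$, and that touches the first ray at $x_+(A)$. Then $\Sigma_A$ and $\gamma$ touch externally at $x_+(A)$. They have exactly three common tangent lines, two of which are the lines $Ax_+(A)$ and $Ax_-(A)$. $F(A)$ is the intersection point of the third common tangent line with the line $Ax_+(A)$. Width: for a direction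 $\alpha$, $w(\alpha)=w_\gamma(\alpha)$ is the distance between the two support lines of $\gamma$ parallel to the vector $(\cos\alpha,\sin\alpha)$. Note that $\partial/\partial\alpha$ has Euclidean length $r$, so $X$ moves points along circles centered at $O$ with speed $2w(\alpha)$. *)

theory Defs
  imports "HOL-Analysis.Analysis"
begin

text \<open>The plane is modelled by the complex numbers. An oval is given by a
parametrisation c :: real => complex which is L-periodic, injective on one
period (simple closed), C-infinity, and has positive signed curvature, i.e.
cross(c', c'') > 0 everywhere; this also fixes the counterclockwise orientation.\<close>

definition cross2 :: "complex \<Rightarrow> complex \<Rightarrow> real" where
  "cross2 a b = Im (cnj a * b)"

definition oval :: "(real \<Rightarrow> complex) \<Rightarrow> real \<Rightarrow> bool" where
  "oval c L \<longleftrightarrow> L > 0 \<and> (\<forall>t. c (t + L) = c t) \<and> inj_on c {0..<L} \<and>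
     (\<exists>D :: nat \<Rightarrow> real \<Rightarrow> complex. D 0 = c \<and>
        (\<forall>n t. (D n has_vector_derivative D (Suc n) t) (at t)) \<and>
        (\<forall>t. cross2 (D 1 t) (D 2 t) > 0))"

definition oval_domain :: "(real \<Rightarrow> complex) \<Rightarrow> real \<Rightarrow> complex set" where
  "oval_domain c L = convex hull (c ` {0..L})"

definition tangent_vec :: "(real \<Rightarrow> complex) \<Rightarrow> real \<Rightarrow> complex" where
  "tangent_vec c t = vector_derivative c (at t)"

definition pos_tangency :: "(real \<Rightarrow> complex) \<Rightarrow> complex \<Rightarrow> complex" where
  "pos_tangency c A = (THE x. \<exists>t. x = c t \<and>
      (\<exists>k>0. c t - A = of_real k * tangent_vec c t))"

definition neg_tangency :: "(real \<Rightarrow> complex) \<Rightarrow> complex \<Rightarrow> complex" where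
  "neg_tangency c A = (THE x. \<exists>t. x = c t \<and>
      (\<exists>k>0. A - c t = of_real k * tangent_vec c t))"

definition ray :: "complex \<Rightarrow> complex \<Rightarrow> complex set" where
  "ray A u = {A + of_real s * u | s. s \<ge> 0}"

definition line :: "complex \<Rightarrow> complex \<Rightarrow> complex set" where
  "line p v = {p + of_real s * v | s. True}"

definition angle_region :: "complex \<Rightarrow> complex \<Rightarrow> complex \<Rightarrow> complex set" where
  "angle_region A u v = {A + of_real s * u + of_real t * v | s t. s \<ge> 0 \<and> t \<ge> 0}"

definition inscribed_in_angle :: "complex \<Rightarrow> real \<Rightarrow> complex \<Rightarrow> complex \<Rightarrow> complex \<Rightarrow> bool" where
  "inscribed_in_angle Z \<rho> A u v \<longleftrightarrow> \<rho> > 0 \<and> cball Z \<rho> \<subseteq> angle_region A u v \<and>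
     ray A u \<inter> sphere Z \<rho> \<noteq> {} \<and> ray A v \<inter> sphere Z \<rho> \<noteq> {}"

definition Sigma_circle :: "(real \<Rightarrow> complex) \<Rightarrow> complex \<Rightarrow> complex \<times> real" where
  "Sigma_circle c A = (let P = pos_tangency c A; M = neg_tangency c A in
     (THE (Z, \<rho>). inscribed_in_angle Z \<rho> A (P - A) (A - M) \<and> P \<in> sphere Z \<rho>))"

definition common_tangents :: "(real \<Rightarrow> complex) \<Rightarrow> complex \<Rightarrow> real \<Rightarrow> complex set set" where
  "common_tangents c Z \<rho> = {l. (\<exists>t. l = line (c t) (tangent_vec c t)) \<and>
                               (\<exists>!p. p \<in> l \<inter> sphere Z \<rho>)}"

definition outer_length_billiard :: "(real \<Rightarrow> complex) \<Rightarrow> complex \<Rightarrow> complex" where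
  "outer_length_billiard c A = (let P = pos_tangency c A; M = neg_tangency c A;
       (Z, \<rho>) = Sigma_circle c A in
     (THE B. \<exists>l \<in> common_tangents c Z \<rho>. l \<noteq> line A (P - A) \<and> l \<noteq> line A (M - A) \<and>
             B \<in> l \<inter> line A (P - A)))"

text \<open>Width in direction alpha: distance between the two support lines of the
oval parallel to (cos alpha, sin alpha), i.e. with unit normal i * cis alpha.\<close>
definition width :: "(real \<Rightarrow> complex) \<Rightarrow> real \<Rightarrow> real \<Rightarrow> real" where
  "width c L \<alpha> = (let u = \<i> * cis \<alpha>; K = oval_domain c L in
     (SUP x\<in>K. x \<bullet> u) - (INF x\<in>K. x \<bullet> u))"

text \<open>The vector field X = -(2 w(alpha)/r) d/d alpha in polar coordinates
centred at Q; d/d alpha at p is the vector i*(p - Q).\<close>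
definition field_X :: "(real \<Rightarrow> complex) \<Rightarrow> real \<Rightarrow> complex \<Rightarrow> complex \<Rightarrow> complex" where
  "field_X c L Q p = - of_real (2 * width c L (Arg (p - Q)) / cmod (p - Q)) * (\<i> * (p - Q))"

definition time1_flow :: "(real \<Rightarrow> complex) \<Rightarrow> real \<Rightarrow> complex \<Rightarrow> complex \<Rightarrow> complex" where
  "time1_flow c L Q x = (THE y. \<exists>\<phi>. \<phi> 0 = x \<and> \<phi> 1 = y \<and>
      (\<forall>t\<in>{0..1}. \<phi> t \<noteq> Q \<and>
         (\<phi> has_vector_derivative field_X c L Q (\<phi> t)) (at t within {0..1})))"

end

theory Submission
  imports Defs
begin

text \<open>By Hopf's theorem on the turning number the tangent angle parametrises the oval: \<open>\<gamma>' s = \<rho> s * cis s\<close>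
  with \<open>\<rho>\<close> bounded between positive constants. An exterior point is determined by the tangent angles
  \<open>\<phi> < \<theta> < \<phi> + pi\<close> of its negative and positive tangency points, and the billiard map sends \<open>(\<phi>, \<theta>)\<close> to
  \<open>(\<theta>, \<psi>)\<close>, where \<open>\<psi>\<close> is found by equating two expressions for the radius \<open>R\<close> of the circle.
  Let \<open>p\<close> and \<open>q\<close> be the tangents of half the angles at these two vertices, and let \<open>w\<close> and \<open>w'\<close> be the width and
  its derivative at \<open>\<theta>\<close>. The step along the line with direction \<open>cis \<theta>\<close> has length \<open>R * (p + q)\<close>, and expanding
  the heights of \<open>\<gamma> \<theta>\<close> over the other two tangent lines gives \<open>2 * R * p\<^sup>2 = w + 2 * p * w' + O(p\<^sup>2)\<close> and
  \<open>2 * R * q\<^sup>2 = w - 2 * q * w' + O(q\<^sup>2)\<close>; hence the length is \<open>w / q - w' + O(q)\<close> and also \<open>w / p + w' + O(p)\<close>.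
  Two consecutive steps therefore have equal lengths up to \<open>O(q)\<close> and almost opposite directions, and they add up to
  \<open>2 * w * \<i> * cis \<theta> + O(q)\<close>, which is the value of the field up to \<open>O(1 / r)\<close>. Along the time-1 flow the field
  changes by \<open>O(1 / r)\<close> only.\<close>

section \<open>Periodic functions, antiderivatives and inverse functions\<close>

lemma shift_into_period:
  fixes p :: real
  assumes "0 < p"
  obtains n :: int where "a \<le> x + of_int n * p" "x + of_int n * p < a + p"
proof -
  define n where "n = - \<lfloor>(x - a) / p\<rfloor>"
  have "a \<le> x + of_int n * p" "x + of_int n * p < a + p"
    using floor_divide_lower[OF assms, of "x - a"] floor_divide_upper[OF assms, of "x - a"]
    by (simp_all add: n_def algebra_simps)
  then show ?thesis using that by blast
qed

lemma periodic_image_period: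
  fixes f :: "real \<Rightarrow> 'a"
  assumes "periodic_fun_simple f p" "0 < p"
  shows "f ` {a..a + p} = range f"
proof -
  interpret periodic_fun_simple f p by (rule assms)
  have "f x \<in> f ` {a..a + p}" for x
  proof -
    obtain n :: int where "a \<le> x + of_int n * p" "x + of_int n * p < a + p"
      using shift_into_period[OF assms(2)] by blast
    moreover have "f x = f (x + of_int n * p)" by (rule plus_of_int[symmetric])
    ultimately show ?thesis by force
  qed
  then show ?thesis by blast
qed

lemma compact_range_periodic:
  fixes f :: "real \<Rightarrow> 'a::topological_space"
  assumes "periodic_fun_simple f p" "0 < p" "continuous_on UNIV f"
  shows "compact (range f)"
proof -
  have "compact (f ` {0..0 + p})"
    by (intro compact_continuous_image continuous_on_subset[OF assms(3)]) auto
  then show ?thesis unfolding periodic_image_period[OF assms(1,2)] .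
qed

lemma periodic_inj_on_period:
  fixes f :: "real \<Rightarrow> 'a"
  assumes per: "periodic_fun_simple f p" and inj: "inj_on f {0..<p}" and xy: "x < y" "y < x + p"
  shows "f x \<noteq> f y"
proof
  interpret periodic_fun_simple f p by (rule per)
  assume "f x = f y"
  have "0 < p" using xy by linarith
  then obtain n :: int where n: "0 \<le> x + of_int n * p" "x + of_int n * p < 0 + p"
    using shift_into_period by blast
  have eq: "f (x + of_int n * p) = f (y + of_int n * p)" "f (y + of_int n * p - p) = f (y + of_int n * p)"
    by (simp_all only: plus_of_int minus_1 \<open>f x = f y\<close>)
  show False
  proof (cases "y + of_int n * p < p")
    case True
    then show False using inj_onD[OF inj eq(1)] n xy by simp
  next
    case False
    then show False
      using inj_onD[OF inj, of "x + of_int n * p" "y + of_int n * p - p"] eq n xy by simp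
  qed
qed

lemma periodic_vector_derivative:
  assumes "\<And>t. (f has_vector_derivative f' t) (at t)" "periodic_fun_simple f p"
  shows "periodic_fun_simple f' p"
proof
  fix t
  have "((\<lambda>x. x + p) has_vector_derivative 1) (at t)"
    by (auto intro!: derivative_eq_intros)
  from vector_diff_chain_at[OF this assms(1)]
  have "(f has_vector_derivative f' (t + p)) (at t)"
    by (simp add: o_def periodic_fun_simple.plus_period[OF assms(2)])
  then show "f' (t + p) = f' t"
    using assms(1) vector_derivative_at by metis
qed

lemma antiderivative_exists:
  fixes f :: "real \<Rightarrow> 'a::euclidean_space"
  assumes "continuous_on UNIV f"
  obtains F where "\<And>x. (F has_vector_derivative f x) (at x)"
proof -
  have "\<exists>F. \<forall>x :: real. - \<infinity> < ereal x \<longrightarrow> ereal x < \<infinity> \<longrightarrow> (F has_vector_derivative f x) (at x)"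
    using assms by (intro einterval_antiderivative) (auto simp: continuous_on_eq_continuous_at)
  then show ?thesis using that by auto
qed

lemma differentiable_inverse_function:
  fixes g g' :: "real \<Rightarrow> real"
  assumes g: "\<And>x. (g has_real_derivative g' x) (at x)" and pos: "\<And>x. 0 < g' x"
    and unbounded: "\<And>y. \<exists>x. g x \<le> y" "\<And>y. \<exists>x. y \<le> g x"
  obtains h where "\<And>x. h (g x) = x" "\<And>y. g (h y) = y"
    "\<And>y. (h has_real_derivative 1 / g' (h y)) (at y)"
proof -
  have mono: "g x < g y" if "x < y" for x y
    by (rule DERIV_pos_imp_increasing[OF that]) (use g pos in blast)
  have cont: "continuous_on S g" for S
    by (rule DERIV_continuous_on[OF has_field_derivative_at_within[OF g]])
  have inj: "inj g"
    by (rule injI) (metis mono less_irrefl linorder_neqE)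
  have surj: "\<exists>x. g x = y" for y
  proof -
    obtain a b where ab: "g a \<le> y" "y \<le> g b" using unbounded by blast
    then have "a \<le> b" using mono[of b a] by linarith
    then show ?thesis using IVT'[OF ab _ cont] by blast
  qed
  define h where "h = inv g"
  have hg: "h (g x) = x" for x by (simp add: h_def inj)
  have gh: "g (h y) = y" for y
    unfolding h_def using surj[of y] by (intro f_inv_into_f) auto
  have "isCont h (g x)" for x
    by (rule isCont_inverse_function[of 1 x h g]) (simp_all add: hg DERIV_isCont[OF g])
  then have "isCont h y" for y by (metis gh)
  then have "(h has_real_derivative inverse (g' (h y))) (at y)" for y
    by (intro DERIV_inverse_function[OF g, of h y "y - 1" "y + 1"])
      (simp_all add: less_imp_neq[OF pos[of "h y"], symmetric] gh)
  then show ?thesis using that[of h] hg gh by (simp add: inverse_eq_divide)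
qed

section \<open>Hopf's theorem on the turning number\<close>

lemma logarithm_of_differentiable:
  fixes f f' :: "real \<Rightarrow> complex"
  assumes f: "\<And>t. (f has_vector_derivative f' t) (at t)" and cont: "continuous_on UNIV f'"
    and nz: "\<And>t. f t \<noteq> 0"
  obtains \<Lambda> where "\<And>t. (\<Lambda> has_vector_derivative f' t / f t) (at t)" "\<And>t. exp (\<Lambda> t) = f t"
proof -
  have "continuous_on UNIV f"
    by (rule continuous_on_vector_derivative[OF has_vector_derivative_at_within[OF f]])
  then obtain F where F: "\<And>t. (F has_vector_derivative f' t / f t) (at t)"
    using antiderivative_exists[of "\<lambda>t. f' t / f t"] cont nz by (metis continuous_on_divide)
  define \<Lambda> where "\<Lambda> = (\<lambda>t. F t + (Ln (f 0) - F 0))"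
  have \<Lambda>: "(\<Lambda> has_vector_derivative f' t / f t) (at t)" for t
    unfolding \<Lambda>_def using has_vector_derivative_add[OF F has_vector_derivative_const] by simp
  have "((\<lambda>t. f t * exp (- \<Lambda> t)) has_derivative (\<lambda>h. 0)) (at t)" for t
  proof -
    have "((\<lambda>t. exp (- \<Lambda> t)) has_vector_derivative - (f' t / f t) * exp (- \<Lambda> t)) (at t)"
      using field_vector_diff_chain_at[OF has_vector_derivative_minus[OF \<Lambda>] DERIV_exp]
      by (simp add: o_def)
    from has_vector_derivative_mult[OF f this]
    show ?thesis using nz by (simp add: has_vector_derivative_def)
  qed
  then have "\<exists>k. \<forall>t\<in>UNIV. f t * exp (- \<Lambda> t) = k"
    by (intro has_derivative_zero_constant) auto
  moreover have "f 0 * exp (- \<Lambda> 0) = 1" using nz by (simp add: \<Lambda>_def exp_minus)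
  ultimately have "f t * exp (- \<Lambda> t) = 1" for t by (metis UNIV_I)
  then have "exp (\<Lambda> t) = f t" for t by (simp add: exp_minus field_simps)
  then show ?thesis using that \<Lambda> by blast
qed

lemma log_increment_unique:
  fixes f g :: "real \<Rightarrow> complex"
  assumes "a \<le> b" and cf: "continuous_on {a..b} f" and cg: "continuous_on {a..b} g"
    and eq: "\<And>x. x \<in> {a..b} \<Longrightarrow> exp (f x) = k * exp (g x)"
  shows "f b - f a = g b - g a"
proof -
  define u where "u = (\<lambda>x. f x - g x)"
  have exp_u: "exp (u x) = k" if "x \<in> {a..b}" for x
    using eq[OF that] by (simp add: u_def exp_diff)
  have "u constant_on {a..b}"
  proof (rule continuous_discrete_range_constant)
    show "connected {a..b}" by simp
    show "continuous_on {a..b} u" unfolding u_def by (intro continuous_intros cf cg)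
    show "\<exists>e>0. \<forall>y. y \<in> {a..b} \<and> u y \<noteq> u x \<longrightarrow> e \<le> norm (u y - u x)" if x: "x \<in> {a..b}" for x
    proof (intro exI[of _ 1] conjI allI impI)
      fix y assume y: "y \<in> {a..b} \<and> u y \<noteq> u x"
      then have "exp (u y) = exp (u x)" using exp_u x by simp
      then have "\<not> \<bar>Im (u y) - Im (u x)\<bar> < 2 * pi" using y exp_complex_eqI by blast
      then have "1 \<le> \<bar>Im (u y - u x)\<bar>" using pi_gt3 by simp
      then show "1 \<le> norm (u y - u x)" using abs_Im_le_cmod order_trans by blast
    qed simp
  qed
  then have "u a = u b" using \<open>a \<le> b\<close> by (auto simp: constant_on_def)
  then show ?thesis by (simp add: u_def algebra_simps)
qed

lemma arg_increment_upper_half_plane: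
  fixes f :: "real \<Rightarrow> complex"
  assumes "a \<le> b" and cont: "continuous_on {a..b} f"
    and upper: "\<And>x. x \<in> {a..b} \<Longrightarrow> 0 \<le> Im (exp (f x))" and opp: "exp (f b) = - exp (f a)"
  shows "\<bar>Im (f b - f a)\<bar> = pi"
proof (rule ccontr)
  assume ne: "\<bar>Im (f b - f a)\<bar> \<noteq> pi"
  have "exp (f b) = exp (f a + \<i> * of_real pi)" using opp by (simp add: exp_add)
  then obtain n :: int where "f b = f a + \<i> * of_real pi + of_real (of_int (2 * n) * pi) * \<i>"
    unfolding exp_eq by blast
  then have n: "Im (f b - f a) = of_int (2 * n + 1) * pi" by (simp add: algebra_simps)
  define lo hi where "lo = min (Im (f a)) (Im (f b))" and "hi = max (Im (f a)) (Im (f b))"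
  have "\<bar>2 * n + 1\<bar> \<noteq> 1"
  proof
    assume "\<bar>2 * n + 1\<bar> = 1"
    then have "\<bar>real_of_int (2 * n + 1)\<bar> = 1" by (simp only: of_int_abs[symmetric] of_int_1)
    then show False using ne unfolding n abs_mult by simp
  qed
  then have "2 \<le> \<bar>2 * n + 1\<bar>" by presburger
  then have "2 \<le> \<bar>real_of_int (2 * n + 1)\<bar>" by linarith
  then have "2 * pi \<le> \<bar>Im (f b - f a)\<bar>" unfolding n abs_mult by simp
  then have gap: "lo + 2 * pi \<le> hi" by (auto simp: lo_def hi_def)
  obtain k :: int where k: "lo \<le> - (pi / 2) + of_int k * (2 * pi)" "- (pi / 2) + of_int k * (2 * pi) < lo + 2 * pi"
    using shift_into_period[of "2 * pi" lo "- (pi / 2)"] pi_gt_zero by auto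
  have "connected ((\<lambda>x. Im (f x)) ` {a..b})"
    by (intro connected_continuous_image continuous_intros cont) simp
  moreover have "lo \<in> (\<lambda>x. Im (f x)) ` {a..b}" "hi \<in> (\<lambda>x. Im (f x)) ` {a..b}"
    using \<open>a \<le> b\<close> by (auto simp: lo_def hi_def min_def max_def)
  ultimately have "{lo..hi} \<subseteq> (\<lambda>x. Im (f x)) ` {a..b}" by (rule connected_contains_Icc)
  then obtain x where x: "x \<in> {a..b}" "Im (f x) = - (pi / 2) + of_int k * (2 * pi)"
    using k gap by (force simp: image_iff)
  have "sin (Im (f x)) = sin (- (pi / 2))"
    unfolding x(2) using sin.plus_of_int[of "- (pi / 2)" k] by simp
  then have "Im (exp (f x)) < 0" by (simp add: Im_exp)
  then show False using upper[OF x(1)] by simp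
qed

locale simple_closed_curve =
  fixes c c' :: "real \<Rightarrow> complex" and L :: real
  assumes L_pos: "0 < L" and periodic: "periodic_fun_simple c L" and inj: "inj_on c {0..<L}"
    and has_deriv: "\<And>t. (c has_vector_derivative c' t) (at t)"
    and continuous_deriv: "continuous_on UNIV c'" and deriv_nonzero: "\<And>t. c' t \<noteq> 0"
begin

sublocale curve: periodic_fun_simple c L by (rule periodic)

sublocale deriv: periodic_fun_simple c' L
  by (rule periodic_vector_derivative[OF has_deriv periodic])

definition secant_slope :: "real \<times> real \<Rightarrow> complex" where
  "secant_slope = (\<lambda>(s, t). integral {0..1} (\<lambda>x. c' (s + x * (t - s))))"

lemma continuous_secant_slope: "continuous_on UNIV secant_slope"
proof -
  have "continuous_on UNIV (\<lambda>p. integral (cbox 0 1) (\<lambda>x. c' (fst p + x * (snd p - fst p))))"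
    by (rule integral_continuous_on_param)
      (auto intro!: continuous_on_compose2[OF continuous_deriv] continuous_intros simp: split_beta)
  then show ?thesis by (simp add: secant_slope_def split_beta)
qed

lemma secant_slope_diagonal: "secant_slope (s, s) = c' s"
  by (simp add: secant_slope_def)

lemma secant_slope_eq:
  assumes "s \<noteq> t"
  shows "secant_slope (s, t) = (c t - c s) / of_real (t - s)"
proof -
  have "((\<lambda>x. of_real (t - s) * c' (s + x * (t - s))) has_integral
           (c (s + 1 * (t - s)) - c (s + 0 * (t - s)))) {0..1}"
  proof (rule fundamental_theorem_of_calculus)
    fix x :: real
    have "((\<lambda>x. s + x * (t - s)) has_vector_derivative (t - s)) (at x)"
      by (auto intro!: derivative_eq_intros)
    from vector_diff_chain_at[OF this has_deriv]
    show "((\<lambda>x. c (s + x * (t - s))) has_vector_derivative of_real (t - s) * c' (s + x * (t - s)))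
        (at x within {0..1})"
      by (auto simp: o_def scaleR_conv_of_real intro: has_vector_derivative_at_within)
  qed simp
  from integral_unique[OF this]
  have "of_real (t - s) * secant_slope (s, t) = c t - c s"
    by (simp add: secant_slope_def)
  then show ?thesis using assms by (simp add: field_simps)
qed

text \<open>A continuous extension of the direction of the secant from \<open>c s\<close> to \<open>c t\<close>, \<open>0 < t - s < L\<close>, to the closed
  strip \<open>0 \<le> t - s \<le> L\<close>: the two slopes belong to the same secant, with \<open>t\<close> replaced by \<open>t - L\<close> in the second.\<close>

definition secant_direction :: "real \<times> real \<Rightarrow> complex" where
  "secant_direction p = secant_slope p - secant_slope (fst p, snd p - L)"

lemma continuous_secant_direction: "continuous_on S secant_direction"
  unfolding secant_direction_def
  by (intro continuous_intros continuous_on_compose2[OF continuous_secant_slope]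
      continuous_on_subset[OF continuous_secant_slope]) auto

lemma secant_direction_ends:
  "secant_direction (s, s) = c' s" "secant_direction (s, s + L) = - c' s"
  using L_pos
  by (simp_all add: secant_direction_def secant_slope_diagonal secant_slope_eq curve.minus_1 curve.plus_1)

lemma secant_direction_between:
  assumes "s < t" "t < s + L"
  shows "secant_direction (s, t) = of_real (1 / (t - s) + 1 / (L - (t - s))) * (c t - c s)"
proof -
  have "of_real (t - L - s) = - (of_real (L - (t - s)) :: complex)" by simp
  then have "secant_slope (s, t - L) = - ((c t - c s) / of_real (L - (t - s)))"
    using assms by (simp only: secant_slope_eq curve.minus_1 divide_minus_right)
  moreover have "secant_slope (s, t) = (c t - c s) / of_real (t - s)"
    using assms by (intro secant_slope_eq) simp
  ultimately show ?thesis
    unfolding secant_direction_def fst_conv snd_conv by (simp add: ring_distribs divide_inverse)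
qed

lemma secant_direction_nonzero:
  assumes "s \<le> t" "t \<le> s + L"
  shows "secant_direction (s, t) \<noteq> 0"
proof -
  consider "t = s" | "t = s + L" | "s < t" "t < s + L" using assms by linarith
  then show ?thesis
  proof cases
    case 3
    then have "1 / (t - s) + 1 / (L - (t - s)) > 0" by (simp add: add_pos_pos)
    moreover have "c t \<noteq> c s" using periodic_inj_on_period[OF periodic inj 3] by simp
    ultimately show ?thesis
      unfolding secant_direction_between[OF 3]
      by (metis eq_iff_diff_eq_0 mult_eq_0_iff of_real_eq_0_iff less_irrefl)
  qed (simp_all add: secant_direction_ends deriv_nonzero)
qed

lemma secant_direction_swap:
  assumes "a \<le> s" "s \<le> a + L"
  shows "secant_direction (s, a + L) = - secant_direction (a, s)"
proof -
  consider "s = a" | "s = a + L" | "a < s" "s < a + L" using assms by linarith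
  then show ?thesis
  proof cases
    case 3
    have "secant_direction (s, a + L) = of_real (1 / (a + L - s) + 1 / (L - (a + L - s))) * (c (a + L) - c s)"
      using 3 by (intro secant_direction_between) auto
    also have "1 / (a + L - s) + 1 / (L - (a + L - s)) = 1 / (s - a) + 1 / (L - (s - a))"
      by (simp add: algebra_simps)
    also have "of_real \<dots> * (c (a + L) - c s) = - secant_direction (a, s)"
      unfolding secant_direction_between[OF 3] curve.plus_1 by (simp only: mult_minus_right[symmetric] minus_diff_eq)
    finally show ?thesis .
  qed (simp_all add: secant_direction_ends deriv.plus_1)
qed

lemma ex_lowest_point: obtains a where "\<And>t. Im (c a) \<le> Im (c t)" "Im (c' a) = 0"
proof -
  have "continuous_on UNIV (\<lambda>t. Im (c t))"
    by (intro continuous_intros continuous_on_vector_derivative[OF has_vector_derivative_at_within[OF has_deriv]])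
  moreover have "periodic_fun_simple (\<lambda>t. Im (c t)) L" by unfold_locales (simp add: curve.plus_1)
  ultimately have "compact (range (\<lambda>t. Im (c t)))" by (intro compact_range_periodic[OF _ L_pos])
  then obtain a where a: "\<And>t. Im (c a) \<le> Im (c t)"
    using compact_attains_inf[of "range (\<lambda>t. Im (c t))"] by auto
  have "Im (c' a) = 0"
    by (rule DERIV_local_min[OF has_field_derivative_Im[OF has_deriv], of 1]) (use a in auto)
  then show ?thesis using that a by blast
qed

lemma secant_direction_upward:
  assumes a: "\<And>t. Im (c a) \<le> Im (c t)" "Im (c' a) = 0" and t: "a \<le> t" "t \<le> a + L"
  shows "0 \<le> Im (secant_direction (a, t))"
proof -
  consider "t = a" | "t = a + L" | "a < t" "t < a + L" using t by linarith
  then show ?thesis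
    by cases (use a(1)[of t] in \<open>simp_all add: secant_direction_ends secant_direction_between a(2)\<close>)
qed

text \<open>Hopf's secant argument on the triangle \<open>a \<le> s \<le> t \<le> a + L\<close>, where \<open>c a\<close> is a lowest point: along the first
  leg the secants point upwards, so their argument changes by half a turn, and it changes by the same amount along
  the second leg.\<close>

lemma turning_at_lowest_point:
  assumes a: "\<And>t. Im (c a) \<le> Im (c t)" "Im (c' a) = 0"
    and \<Lambda>: "continuous_on UNIV \<Lambda>" "\<And>t. exp (\<Lambda> t) = c' t"
  shows "\<bar>Im (\<Lambda> (a + L) - \<Lambda> a)\<bar> = 2 * pi"
proof -
  define T where "T = {p. a \<le> fst p \<and> fst p \<le> snd p \<and> snd p \<le> a + L}"
  have "T = {p. inner (-1, 0) p \<le> - a} \<inter> {p. inner (1, -1) p \<le> 0} \<inter> {p. inner (0, 1) p \<le> a + L}"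
    by (auto simp: T_def inner_prod_def)
  then have "convex T" by (simp only: convex_Int convex_halfspace_le)
  moreover have "secant_direction p \<noteq> 0" if "p \<in> T" for p
    using that secant_direction_nonzero[of "fst p" "snd p"] by (simp add: T_def)
  ultimately obtain h where h: "continuous_on T h" "\<And>p. p \<in> T \<Longrightarrow> exp (h p) = secant_direction p"
    using continuous_logarithm_on_contractible[OF continuous_secant_direction convex_imp_contractible] by metis
  have side_mem: "(a, t) \<in> T" "(t, a + L) \<in> T" "(t, t) \<in> T" if "t \<in> {a..a + L}" for t
    using that by (auto simp: T_def)
  have side_cont: "continuous_on {a..a + L} (\<lambda>t. h (a, t))" "continuous_on {a..a + L} (\<lambda>t. h (t, a + L))"
    "continuous_on {a..a + L} (\<lambda>t. h (t, t))"
    using side_mem by (auto intro!: continuous_on_compose2[OF h(1)] continuous_intros)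
  have upper: "0 \<le> Im (exp (h (a, t)))" if "t \<in> {a..a + L}" for t
    using that secant_direction_upward[OF a, of t] by (simp add: h(2) side_mem)
  have first_leg: "\<bar>Im (h (a, a + L) - h (a, a))\<bar> = pi"
    by (rule arg_increment_upper_half_plane[OF _ side_cont(1) upper])
      (use L_pos in \<open>auto simp: h(2) side_mem secant_direction_ends\<close>)
  have "exp (h (s, a + L)) = - 1 * exp (h (a, s))" if "s \<in> {a..a + L}" for s
    using that secant_direction_swap[of a s] by (simp add: h(2) side_mem)
  then have second_leg: "h (a + L, a + L) - h (a, a + L) = h (a, a + L) - h (a, a)"
    by (intro log_increment_unique[where k = "- 1", OF _ side_cont(2,1)]) (use L_pos in auto)
  have "exp (h (s, s)) = 1 * exp (\<Lambda> s)" if "s \<in> {a..a + L}" for s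
    using that by (simp add: h(2) side_mem secant_direction_ends \<Lambda>(2))
  then have "h (a + L, a + L) - h (a, a) = \<Lambda> (a + L) - \<Lambda> a"
    by (intro log_increment_unique[where k = 1, OF _ side_cont(3) continuous_on_subset[OF \<Lambda>(1)]])
      (use L_pos in auto)
  then have "\<Lambda> (a + L) - \<Lambda> a = (h (a + L, a + L) - h (a, a + L)) + (h (a, a + L) - h (a, a))" by simp
  then have "\<Lambda> (a + L) - \<Lambda> a = 2 * (h (a, a + L) - h (a, a))" unfolding second_leg by simp
  then show ?thesis using first_leg by (simp add: abs_mult)
qed

theorem turning_number:
  assumes \<Lambda>: "continuous_on UNIV \<Lambda>" "\<And>t. exp (\<Lambda> t) = c' t"
  shows "\<bar>Im (\<Lambda> (t + L) - \<Lambda> t)\<bar> = 2 * pi"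
proof -
  have increment: "\<Lambda> (y + L) - \<Lambda> (x + L) = \<Lambda> y - \<Lambda> x" if "x \<le> y" for x y
    by (rule log_increment_unique[where f = "\<lambda>t. \<Lambda> (t + L)" and k = 1])
      (use that in \<open>auto intro!: continuous_on_compose2[OF \<Lambda>(1)] continuous_on_subset[OF \<Lambda>(1)] continuous_intros
        simp: \<Lambda>(2) deriv.plus_1\<close>)
  obtain a where a: "\<And>t. Im (c a) \<le> Im (c t)" "Im (c' a) = 0" using ex_lowest_point by blast
  have "\<Lambda> (t + L) - \<Lambda> t = \<Lambda> (a + L) - \<Lambda> a"
    using increment[of a t] increment[of t a] by (cases "a \<le> t") (auto simp: algebra_simps)
  then show ?thesis using turning_at_lowest_point[OF a \<Lambda>] by simp
qed

end

section \<open>The rotating frame\<close>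

lemma cross2_expand: "cross2 a b = Re a * Im b - Im a * Re b"
  by (simp add: cross2_def)

lemma cross2_linear:
  "cross2 a (x + y) = cross2 a x + cross2 a y" "cross2 a (x - y) = cross2 a x - cross2 a y"
  "cross2 a (of_real k * x) = k * cross2 a x" "cross2 a (- x) = - cross2 a x"
  "cross2 (a - b) x = cross2 a x - cross2 b x" "cross2 (- a) x = - cross2 a x"
  by (auto simp: cross2_expand algebra_simps)

lemma cross2_eq_inner: "cross2 a b = (\<i> * a) \<bullet> b"
  by (simp add: cross2_expand inner_complex_def)

lemma abs_cross2_le: "\<bar>cross2 a b\<bar> \<le> cmod a * cmod b"
  unfolding cross2_eq_inner by (rule order_trans[OF Cauchy_Schwarz_ineq2]) (simp add: norm_mult)

lemma cross2_cis: "cross2 (cis a) (cis b) = sin (b - a)"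
  by (simp add: cross2_expand sin_diff algebra_simps)

lemma cross2_cis_i_cis: "cross2 (cis a) (\<i> * cis b) = cos (b - a)"
  by (simp add: cross2_expand cos_diff algebra_simps)

lemma cis_plus_pi: "cis (a + pi) = - cis a" and cis_minus_pi: "cis (a - pi) = - cis a"
  by (simp_all add: complex_eq_iff)

lemma cis_eq_iff_int_multiple: "cis s = cis t \<longleftrightarrow> (\<exists>n::int. s = t + of_int n * (2 * pi))"
  by (simp add: complex_eq_iff conj_commute[of "cos s = cos t"] sin_cos_eq_iff mult_ac)

lemma cis_eq_of_cos_eq_1: "cos (s - t) = 1 \<Longrightarrow> cis s = cis t"
  by (auto simp: cos_one_2pi_int cis_eq_iff_int_multiple diff_eq_eq add.commute)

lemma cmod_cis_Arg: "of_real (cmod z) * cis (Arg z) = z"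
  by (metis rcis_cmod_Arg rcis_def)

lemma cnj_cis_mult: "cnj (cis a) * z = Complex (cis a \<bullet> z) (cross2 (cis a) z)"
  by (simp add: complex_eq_iff inner_complex_def cross2_expand)

lemma cis_frame_decomposition:
  "z = of_real (cis a \<bullet> z) * cis a + of_real (cross2 (cis a) z) * (\<i> * cis a)"
proof -
  have "z = cis a * (cnj (cis a) * z)"
    by (simp add: cis_cnj mult.assoc[symmetric] cis_mult)
  then show ?thesis unfolding cnj_cis_mult Complex_eq by (simp add: algebra_simps)
qed

lemma cmod_cis_frame: "(cmod z)\<^sup>2 = (cis a \<bullet> z)\<^sup>2 + (cross2 (cis a) z)\<^sup>2"
proof -
  have "cmod z = cmod (cnj (cis a) * z)" by (simp add: norm_mult)
  then show ?thesis unfolding cnj_cis_mult by (simp add: cmod_power2)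
qed

lemma rotating_frame_derivatives:
  fixes f :: "real \<Rightarrow> complex"
  assumes "(f has_vector_derivative of_real k * cis \<alpha>) (at \<alpha>)"
  shows "((\<lambda>\<alpha>. cross2 (cis \<alpha>) (f \<alpha>)) has_real_derivative - (cis \<alpha> \<bullet> f \<alpha>)) (at \<alpha>)"
    and "((\<lambda>\<alpha>. cis \<alpha> \<bullet> f \<alpha>) has_real_derivative k + cross2 (cis \<alpha>) (f \<alpha>)) (at \<alpha>)"
proof -
  have [derivative_intros]: "((\<lambda>\<alpha>. Re (f \<alpha>)) has_real_derivative k * cos \<alpha>) (at \<alpha>)"
    "((\<lambda>\<alpha>. Im (f \<alpha>)) has_real_derivative k * sin \<alpha>) (at \<alpha>)"
    using has_field_derivative_Re[OF assms] has_field_derivative_Im[OF assms] by simp_all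
  show "((\<lambda>\<alpha>. cross2 (cis \<alpha>) (f \<alpha>)) has_real_derivative - (cis \<alpha> \<bullet> f \<alpha>)) (at \<alpha>)"
    unfolding cross2_expand inner_complex_def
    by (auto intro!: derivative_eq_intros simp: algebra_simps)
  have "((\<lambda>\<alpha>. cis \<alpha> \<bullet> f \<alpha>) has_real_derivative
      k * (cos \<alpha> * cos \<alpha> + sin \<alpha> * sin \<alpha>) + cross2 (cis \<alpha>) (f \<alpha>)) (at \<alpha>)"
    unfolding cross2_expand inner_complex_def
    by (auto intro!: derivative_eq_intros simp: algebra_simps simp del: sin_cos_squared_add3)
  then show "((\<lambda>\<alpha>. cis \<alpha> \<bullet> f \<alpha>) has_real_derivative k + cross2 (cis \<alpha>) (f \<alpha>)) (at \<alpha>)" by simp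
qed

section \<open>Ovals parametrised by the tangent angle\<close>

locale angle_curve =
  fixes \<gamma> :: "real \<Rightarrow> complex" and \<rho> :: "real \<Rightarrow> real" and m M :: real
  assumes deriv: "\<And>s. (\<gamma> has_vector_derivative of_real (\<rho> s) * cis s) (at s)"
    and periodic: "periodic_fun_simple \<gamma> (2 * pi)"
    and m_pos: "0 < m" and m_le: "\<And>s. m \<le> \<rho> s" and le_M: "\<And>s. \<rho> s \<le> M"

locale oval_chart = angle_curve +
  fixes c :: "real \<Rightarrow> complex" and L :: real and \<Theta> :: "real \<Rightarrow> real"
  assumes curve_eq: "\<And>t. c t = \<gamma> (\<Theta> t)"
    and tangent_direction: "\<And>t. tangent_vec c t = of_real (cmod (tangent_vec c t)) * cis (\<Theta> t)"
    and tangent_nonzero: "\<And>t. tangent_vec c t \<noteq> 0"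
    and surj_angle: "surj \<Theta>"
    and domain_eq: "oval_domain c L = convex hull range \<gamma>"

lemma oval_derivatives:
  assumes "oval c L"
  obtains c' c'' where "simple_closed_curve c c' L" "\<And>t. (c' has_vector_derivative c'' t) (at t)"
    "continuous_on UNIV c''" "\<And>t. 0 < cross2 (c' t) (c'' t)"
proof -
  obtain D :: "nat \<Rightarrow> real \<Rightarrow> complex" where "L > 0" and per: "\<And>t. c (t + L) = c t"
    and "inj_on c {0..<L}" and D0: "D 0 = c"
    and D: "\<And>n t. (D n has_vector_derivative D (Suc n) t) (at t)"
    and curv: "\<And>t. cross2 (D 1 t) (D 2 t) > 0"
    using assms unfolding oval_def by blast
  have cont: "continuous_on UNIV (D n)" for n
    by (rule continuous_on_vector_derivative[OF has_vector_derivative_at_within[OF D]])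
  have "D 1 t \<noteq> 0" for t using curv[of t] by (auto simp: cross2_def)
  then have "simple_closed_curve c (D 1) L"
    using D[of 0] \<open>L > 0\<close> \<open>inj_on c {0..<L}\<close> cont by unfold_locales (simp_all add: D0 per)
  moreover have "(D 1 has_vector_derivative D 2 t) (at t)" for t using D[of 1] by (simp add: numeral_2_eq_2)
  ultimately show ?thesis using that cont curv by blast
qed

context simple_closed_curve
begin

definition angular_speed :: "(real \<Rightarrow> complex) \<Rightarrow> real \<Rightarrow> real" where
  "angular_speed c'' t = cross2 (c' t) (c'' t) / (cmod (c' t))\<^sup>2"

lemma angular_speed_pos: "0 < cross2 (c' t) (c'' t) \<Longrightarrow> 0 < angular_speed c'' t"
  using deriv_nonzero by (simp add: angular_speed_def)

lemma tangent_angle_exists: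
  assumes c'': "\<And>t. (c' has_vector_derivative c'' t) (at t)" "continuous_on UNIV c''"
    and curved: "\<And>t. 0 < cross2 (c' t) (c'' t)"
  obtains \<Theta> where "\<And>t. c' t = of_real (cmod (c' t)) * cis (\<Theta> t)"
    "\<And>t. (\<Theta> has_real_derivative angular_speed c'' t) (at t)"
    "\<And>t. \<Theta> (t + L) = \<Theta> t + 2 * pi"
proof -
  obtain \<Lambda> where \<Lambda>: "\<And>t. (\<Lambda> has_vector_derivative c'' t / c' t) (at t)" "\<And>t. exp (\<Lambda> t) = c' t"
    using logarithm_of_differentiable[OF c'' deriv_nonzero] by blast
  define \<Theta> where "\<Theta> = (\<lambda>t. Im (\<Lambda> t))"
  have polar: "c' t = of_real (cmod (c' t)) * cis (\<Theta> t)" for t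
    unfolding \<Lambda>(2)[symmetric] norm_exp_eq_Re \<Theta>_def by (metis exp_eq_polar)
  have "Im (c'' t / c' t) = angular_speed c'' t" for t
    by (simp add: angular_speed_def Im_divide cross2_expand cmod_power2 algebra_simps)
  then have \<Theta>: "(\<Theta> has_real_derivative angular_speed c'' t) (at t)" for t
    unfolding \<Theta>_def using has_field_derivative_Im[OF \<Lambda>(1)[of t]] by simp
  have speed_pos: "0 < angular_speed c'' t" for t by (intro angular_speed_pos curved)
  have increasing: "\<Theta> t < \<Theta> (t + L)" for t
  proof (rule DERIV_pos_imp_increasing[where f = \<Theta>])
    show "\<exists>y. (\<Theta> has_real_derivative y) (at s) \<and> 0 < y" for s
      using \<Theta> speed_pos by blast
  qed (use L_pos in simp)
  have "continuous_on UNIV \<Lambda>"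
    by (rule continuous_on_vector_derivative[OF has_vector_derivative_at_within[OF \<Lambda>(1)]])
  then have turn: "\<bar>\<Theta> (t + L) - \<Theta> t\<bar> = 2 * pi" for t
    using turning_number[OF _ \<Lambda>(2), of t] by (simp add: \<Theta>_def)
  have "\<Theta> (t + L) = \<Theta> t + 2 * pi" for t using increasing[of t] turn[of t] by linarith
  then show ?thesis using that polar \<Theta> by blast
qed

lemma curvature_radius_bounds:
  assumes c'': "\<And>t. (c' has_vector_derivative c'' t) (at t)" "continuous_on UNIV c''"
    and curved: "\<And>t. 0 < cross2 (c' t) (c'' t)"
  obtains m M where "0 < m" "\<And>t. m \<le> cmod (c' t) / angular_speed c'' t" "\<And>t. cmod (c' t) / angular_speed c'' t \<le> M"
proof -
  define q where "q = (\<lambda>t. cmod (c' t) / angular_speed c'' t)"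
  have "continuous_on UNIV q"
    unfolding q_def angular_speed_def cross2_def
    by (intro continuous_intros continuous_deriv c''(2)) (use curved deriv_nonzero in \<open>auto simp: cross2_def less_le\<close>)
  moreover have "periodic_fun_simple c'' L"
    by (rule periodic_vector_derivative[OF c''(1)]) unfold_locales
  then have "periodic_fun_simple q L"
    by unfold_locales (simp add: q_def angular_speed_def deriv.plus_1 periodic_fun_simple.plus_period)
  ultimately have "compact (range q)" by (intro compact_range_periodic[OF _ L_pos])
  then obtain t1 t2 where "\<And>t. q t1 \<le> q t" "\<And>t. q t \<le> q t2"
    using compact_attains_inf[of "range q"] compact_attains_sup[of "range q"] by auto
  moreover have "0 < q t1" using angular_speed_pos[of t1 c''] curved deriv_nonzero by (simp add: q_def)
  ultimately show ?thesis using that unfolding q_def by blast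
qed

end

lemma inverse_of_quasiperiodic:
  fixes \<Theta> \<kappa> :: "real \<Rightarrow> real"
  assumes \<Theta>: "\<And>t. (\<Theta> has_real_derivative \<kappa> t) (at t)" and pos: "\<And>t. 0 < \<kappa> t"
    and shift: "\<And>t. \<Theta> (t + L) = \<Theta> t + p" and p: "0 < p"
  obtains \<tau> where "\<And>t. \<tau> (\<Theta> t) = t" "\<And>s. \<Theta> (\<tau> s) = s"
    "\<And>s. (\<tau> has_real_derivative 1 / \<kappa> (\<tau> s)) (at s)" "\<And>s. \<tau> (s + p) = \<tau> s + L"
proof -
  have iterate: "\<Theta> (real n * L) = \<Theta> 0 + real n * p" "\<Theta> (- (real n * L)) = \<Theta> 0 - real n * p" for n
  proof (induction n)
    case (Suc n)
    show "\<Theta> (real (Suc n) * L) = \<Theta> 0 + real (Suc n) * p"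
      using shift[of "real n * L"] Suc(1) by (simp add: algebra_simps)
    show "\<Theta> (- (real (Suc n) * L)) = \<Theta> 0 - real (Suc n) * p"
      using shift[of "- (real (Suc n) * L)"] Suc(2) by (simp add: algebra_simps)
  qed simp_all
  have "\<exists>x. \<Theta> x \<le> y" "\<exists>x. y \<le> \<Theta> x" for y
  proof -
    obtain n where "\<bar>y - \<Theta> 0\<bar> < real n * p" using reals_Archimedean3[OF p] by blast
    then have "\<Theta> (- (real n * L)) \<le> y" "y \<le> \<Theta> (real n * L)" unfolding iterate by linarith+
    then show "\<exists>x. \<Theta> x \<le> y" "\<exists>x. y \<le> \<Theta> x" by blast+
  qed
  then obtain \<tau> where \<tau>: "\<And>t. \<tau> (\<Theta> t) = t" "\<And>s. \<Theta> (\<tau> s) = s"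
    "\<And>s. (\<tau> has_real_derivative 1 / \<kappa> (\<tau> s)) (at s)"
    using differentiable_inverse_function[OF \<Theta> pos] by metis
  have "\<tau> (s + p) = \<tau> s + L" for s by (metis \<tau>(1,2) shift)
  then show ?thesis using that \<tau> by blast
qed

theorem oval_has_chart:
  assumes "oval c L"
  obtains \<gamma> \<rho> m M \<Theta> where "oval_chart \<gamma> \<rho> m M c L \<Theta>"
proof -
  obtain c' c'' where curve: "simple_closed_curve c c' L"
    and c'': "\<And>t. (c' has_vector_derivative c'' t) (at t)" "continuous_on UNIV c''"
    and curved: "\<And>t. 0 < cross2 (c' t) (c'' t)"
    using oval_derivatives[OF assms] by blast
  interpret simple_closed_curve c c' L by (rule curve)
  let ?\<kappa> = "angular_speed c''"
  obtain \<Theta> where polar: "\<And>t. c' t = of_real (cmod (c' t)) * cis (\<Theta> t)"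
    and \<Theta>: "\<And>t. (\<Theta> has_real_derivative ?\<kappa> t) (at t)" "\<And>t. \<Theta> (t + L) = \<Theta> t + 2 * pi"
    using tangent_angle_exists[OF c'' curved] by blast
  have "0 < ?\<kappa> t" for t by (intro angular_speed_pos curved)
  then obtain \<tau> where \<tau>: "\<And>t. \<tau> (\<Theta> t) = t" "\<And>s. \<Theta> (\<tau> s) = s"
    "\<And>s. (\<tau> has_real_derivative 1 / ?\<kappa> (\<tau> s)) (at s)" "\<And>s. \<tau> (s + 2 * pi) = \<tau> s + L"
    using inverse_of_quasiperiodic[OF \<Theta>(1) _ \<Theta>(2)] by auto
  define \<gamma> where "\<gamma> = (\<lambda>s. c (\<tau> s))"
  have deriv\<gamma>: "(\<gamma> has_vector_derivative of_real (cmod (c' (\<tau> s)) / ?\<kappa> (\<tau> s)) * cis s) (at s)" for s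
  proof -
    have "(\<tau> has_vector_derivative 1 / ?\<kappa> (\<tau> s)) (at s)"
      using \<tau>(3) by (simp add: has_real_derivative_iff_has_vector_derivative)
    from vector_diff_chain_at[OF this has_deriv] show ?thesis
      using polar[of "\<tau> s"] by (simp add: \<gamma>_def o_def \<tau>(2) scaleR_conv_of_real)
  qed
  obtain m M where bounds: "0 < m" "\<And>t. m \<le> cmod (c' t) / ?\<kappa> t" "\<And>t. cmod (c' t) / ?\<kappa> t \<le> M"
    using curvature_radius_bounds[OF c'' curved] by blast
  have "tangent_vec c t = c' t" for t
    unfolding tangent_vec_def using has_deriv by (rule vector_derivative_at)
  moreover have "range \<gamma> = c ` range \<tau>" by (simp add: \<gamma>_def image_image)
  then have "oval_domain c L = convex hull range \<gamma>"
    using periodic_image_period[OF periodic L_pos, of 0] surjI[of \<tau> \<Theta>, OF \<tau>(1)]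
    by (simp add: oval_domain_def)
  ultimately have "oval_chart \<gamma> (\<lambda>s. cmod (c' (\<tau> s)) / ?\<kappa> (\<tau> s)) m M c L \<Theta>"
    using deriv\<gamma> bounds polar deriv_nonzero surjI[of \<Theta> \<tau>, OF \<tau>(2)]
    by unfold_locales (simp_all add: \<gamma>_def \<tau> curve.plus_1)
  then show ?thesis using that by blast
qed

section \<open>Heights over tangent lines and the breadth function\<close>

lemma cis_inj_near: "cis s = cis t \<Longrightarrow> \<bar>s - t\<bar> < 2 * pi \<Longrightarrow> s = t"
proof -
  assume "cis s = cis t" and near: "\<bar>s - t\<bar> < 2 * pi"
  then obtain n :: int where n: "s = t + of_int n * (2 * pi)" unfolding cis_eq_iff_int_multiple by blast
  then have "\<bar>real_of_int n\<bar> < 1" using near by (simp add: abs_mult)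
  then show "s = t" using n by auto
qed

lemma minimum_of_sin_derivative:
  assumes F: "\<And>x. (F has_real_derivative q x * sin (x - \<psi>)) (at x)" and q: "\<And>x. 0 \<le> q x"
    and per: "periodic_fun_simple F (2 * pi)"
  shows "F \<psi> \<le> F s"
proof -
  obtain n :: int where n: "\<psi> - pi \<le> s + of_int n * (2 * pi)" "s + of_int n * (2 * pi) < \<psi> - pi + 2 * pi"
    using shift_into_period[of "2 * pi" "\<psi> - pi" s] pi_gt_zero by auto
  define s' where "s' = s + of_int n * (2 * pi)"
  have "F \<psi> \<le> F s'"
  proof (cases "\<psi> \<le> s'")
    case True
    show ?thesis
    proof (rule DERIV_nonneg_imp_nondecreasing[OF True])
      fix x assume "\<psi> \<le> x" "x \<le> s'"
      then have "0 \<le> sin (x - \<psi>)" using n by (intro sin_ge_zero) (auto simp: s'_def)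
      then show "\<exists>y. (F has_real_derivative y) (at x) \<and> 0 \<le> y" using F q mult_nonneg_nonneg by blast
    qed
  next
    case False
    then have "s' \<le> \<psi>" by simp
    then show ?thesis
    proof (rule DERIV_nonpos_imp_nonincreasing)
      fix x assume "s' \<le> x" "x \<le> \<psi>"
      then have "0 \<le> sin (\<psi> - x)" using n by (intro sin_ge_zero) (auto simp: s'_def)
      then have "sin (x - \<psi>) \<le> 0" using sin_minus[of "\<psi> - x"] by simp
      then show "\<exists>y. (F has_real_derivative y) (at x) \<and> y \<le> 0" using F q mult_nonneg_nonpos by blast
    qed
  qed
  moreover have "F s' = F s"
  proof -
    interpret periodic_fun_simple F "2 * pi" by (rule per)
    show ?thesis unfolding s'_def by (rule plus_of_int)
  qed
  ultimately show ?thesis by simp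
qed

context angle_curve
begin

sublocale curve: periodic_fun_simple \<gamma> "2 * pi" by (rule periodic)

lemma m_le_M: "m \<le> M" and M_pos: "0 < M" and rho_pos: "0 < \<rho> s"
  using m_pos m_le[of 0] le_M[of 0] m_le[of s] by linarith+

lemma gamma_cong: "cis s = cis t \<Longrightarrow> \<gamma> s = \<gamma> t"
  unfolding cis_eq_iff_int_multiple using curve.plus_of_int by auto

lemma continuous_gamma: "continuous_on S \<gamma>"
  by (rule continuous_on_vector_derivative[OF has_vector_derivative_at_within[OF deriv]])

text \<open>\<open>height \<psi> s\<close> is the distance of \<open>\<gamma> s\<close> from the tangent line at \<open>\<gamma> \<psi>\<close>, and \<open>shadow \<psi> s\<close> is
  the coordinate of its projection to that line.\<close>

definition height :: "real \<Rightarrow> real \<Rightarrow> real" where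
  "height \<psi> s = cross2 (cis \<psi>) (\<gamma> s - \<gamma> \<psi>)"

definition shadow :: "real \<Rightarrow> real \<Rightarrow> real" where
  "shadow \<psi> s = cis \<psi> \<bullet> (\<gamma> s - \<gamma> \<psi>)"

lemma height_self: "height \<psi> \<psi> = 0"
  by (simp add: height_def cross2_def)

lemma height_cong: "cis \<psi> = cis \<psi>' \<Longrightarrow> cis s = cis s' \<Longrightarrow> height \<psi> s = height \<psi>' s'"
  using gamma_cong[of \<psi> \<psi>'] gamma_cong[of s s'] by (simp add: height_def)

lemma height_deriv: "(height \<psi> has_real_derivative \<rho> s * sin (s - \<psi>)) (at s)"
proof -
  have "((\<lambda>s. \<gamma> s - \<gamma> \<psi>) has_vector_derivative of_real (\<rho> s) * cis s) (at s)"
    using has_vector_derivative_diff[OF deriv has_vector_derivative_const] by simp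
  from bounded_linear.has_vector_derivative[OF bounded_linear_inner_right this, of "\<i> * cis \<psi>"]
  show ?thesis
    by (simp add: has_real_derivative_iff_has_vector_derivative height_def[abs_def]
        cross2_eq_inner[symmetric] cross2_linear(3) cross2_cis del: inner_mult_left)
qed

lemma height_base_deriv: "((\<lambda>\<psi>. height \<psi> s) has_real_derivative - shadow \<psi> s) (at \<psi>)"
  and shadow_base_deriv: "((\<lambda>\<psi>. shadow \<psi> s) has_real_derivative height \<psi> s - \<rho> \<psi>) (at \<psi>)"
proof -
  have "((\<lambda>\<psi>. \<gamma> s - \<gamma> \<psi>) has_vector_derivative of_real (- \<rho> \<psi>) * cis \<psi>) (at \<psi>)"
    using has_vector_derivative_diff[OF has_vector_derivative_const deriv[of \<psi>]] by simp
  from rotating_frame_derivatives[OF this]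
  show "((\<lambda>\<psi>. height \<psi> s) has_real_derivative - shadow \<psi> s) (at \<psi>)"
    "((\<lambda>\<psi>. shadow \<psi> s) has_real_derivative height \<psi> s - \<rho> \<psi>) (at \<psi>)"
    by (simp_all add: height_def shadow_def)
qed

lemma height_ge: "m * (1 - cos (s - \<psi>)) \<le> height \<psi> s"
  and height_le: "height \<psi> s \<le> M * (1 - cos (s - \<psi>))"
proof -
  have "height \<psi> (x + 2 * pi) = height \<psi> x" "cos (x + 2 * pi - \<psi>) = cos (x - \<psi>)" for x
    using cos_periodic[of "x - \<psi>"] by (simp_all only: height_def curve.plus_1 add_diff_eq diff_add_eq)
  then have per: "periodic_fun_simple (\<lambda>s. height \<psi> s - m * (1 - cos (s - \<psi>))) (2 * pi)"
    "periodic_fun_simple (\<lambda>s. M * (1 - cos (s - \<psi>)) - height \<psi> s) (2 * pi)"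
    by (simp_all add: periodic_fun_simple_def)
  have deriv: "((\<lambda>s. height \<psi> s - m * (1 - cos (s - \<psi>))) has_real_derivative (\<rho> x - m) * sin (x - \<psi>)) (at x)"
    "((\<lambda>s. M * (1 - cos (s - \<psi>)) - height \<psi> s) has_real_derivative (M - \<rho> x) * sin (x - \<psi>)) (at x)" for x
    by (auto intro!: derivative_eq_intros height_deriv simp: algebra_simps)
  show "m * (1 - cos (s - \<psi>)) \<le> height \<psi> s"
    using minimum_of_sin_derivative[OF deriv(1) _ per(1), of s] m_le by (simp add: height_self)
  show "height \<psi> s \<le> M * (1 - cos (s - \<psi>))"
    using minimum_of_sin_derivative[OF deriv(2) _ per(2), of s] le_M by (simp add: height_self)
qed

lemma height_le_2M: "height \<psi> s \<le> 2 * M"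
proof -
  have "M * (1 - cos (s - \<psi>)) \<le> M * 2"
    using M_pos cos_ge_minus_one[of "s - \<psi>"] by (intro mult_left_mono) auto
  then show ?thesis using height_le[of \<psi> s] by simp
qed

lemma height_pos: "cis s \<noteq> cis \<psi> \<Longrightarrow> 0 < height \<psi> s"
proof -
  assume "cis s \<noteq> cis \<psi>"
  then have "cos (s - \<psi>) < 1" using cis_eq_of_cos_eq_1 cos_le_one less_le by blast
  then have "0 < m * (1 - cos (s - \<psi>))" using m_pos by simp
  then show ?thesis using height_ge[of s \<psi>] by linarith
qed

lemma height_nonneg: "0 \<le> height \<psi> s"
  using height_pos[of s \<psi>] height_cong[of \<psi> \<psi> s \<psi>] height_self[of \<psi>] by fastforce

lemma height_pos_near: "s \<noteq> \<psi> \<Longrightarrow> \<bar>s - \<psi>\<bar> < 2 * pi \<Longrightarrow> 0 < height \<psi> s"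
  using height_pos cis_inj_near by blast

abbreviation "body \<equiv> convex hull (range \<gamma>)"

lemma gamma_in_body: "\<gamma> s \<in> body"
  by (simp add: hull_inc)

lemma compact_body: "compact body"
  by (intro compact_convex_hull compact_range_periodic[OF periodic] continuous_gamma) simp

lemma body_in_halfplane: "x \<in> body \<Longrightarrow> 0 \<le> cross2 (cis \<psi>) (x - \<gamma> \<psi>)"
proof -
  assume x: "x \<in> body"
  have "body \<subseteq> {x. cross2 (cis \<psi>) (\<gamma> \<psi>) \<le> (\<i> * cis \<psi>) \<bullet> x}"
    using height_nonneg[of \<psi>]
    by (intro hull_minimal convex_halfspace_ge) (auto simp: height_def cross2_eq_inner inner_diff_right)
  then show ?thesis using x by (auto simp: cross2_eq_inner inner_diff_right)
qed

lemma cmod_body_diff: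
  assumes "x \<in> body"
  shows "cmod (\<gamma> s - x) \<le> 2 * M"
proof -
  have "cmod (\<gamma> s - \<gamma> t) \<le> 2 * M" for t
  proof -
    define a where "a = Arg (\<gamma> s - \<gamma> t) - pi / 2"
    have "cross2 (cis a) (\<gamma> s - \<gamma> t) = cmod (\<gamma> s - \<gamma> t) * cross2 (cis a) (cis (Arg (\<gamma> s - \<gamma> t)))"
      by (metis cross2_linear(3) rcis_cmod_Arg rcis_def)
    then have "cmod (\<gamma> s - \<gamma> t) = height a s - height a t"
      by (simp add: cross2_cis a_def height_def cross2_linear)
    then show ?thesis using height_le_2M[of a s] height_nonneg[of a t] by linarith
  qed
  then have "body \<subseteq> cball (\<gamma> s) (2 * M)"
    by (intro hull_minimal) (auto simp: dist_norm)
  then show ?thesis using assms by (auto simp: dist_norm)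
qed

definition breadth :: "real \<Rightarrow> real" where
  "breadth \<alpha> = height \<alpha> (\<alpha> + pi)"

definition breadth_deriv :: "real \<Rightarrow> real" where
  "breadth_deriv \<alpha> = - shadow \<alpha> (\<alpha> + pi)"

lemma breadth_eq: "breadth \<alpha> = cross2 (cis \<alpha>) (\<gamma> (\<alpha> + pi) - \<gamma> \<alpha>)"
  by (simp add: breadth_def height_def)

lemma breadth_pos: "0 < breadth \<alpha>"
  unfolding breadth_def by (rule height_pos_near) auto

lemma breadth_le: "breadth \<alpha> \<le> 2 * M"
  unfolding breadth_def by (rule height_le_2M)

lemma gamma_minus_pi: "\<gamma> (\<alpha> - pi) = \<gamma> (\<alpha> + pi)"
  by (rule gamma_cong) (simp add: cis_plus_pi cis_minus_pi)

lemma height_opposite: "height (\<alpha> + pi) \<alpha> = breadth \<alpha>"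
  and shadow_opposite: "shadow (\<alpha> + pi) \<alpha> = - breadth_deriv \<alpha>"
  by (simp_all add: breadth_eq breadth_deriv_def height_def shadow_def cis_plus_pi cross2_linear inner_diff_right)

lemma breadth_plus_pi: "breadth (\<alpha> + pi) = breadth \<alpha>"
  and breadth_deriv_plus_pi: "breadth_deriv (\<alpha> + pi) = breadth_deriv \<alpha>"
proof -
  have "\<gamma> (\<alpha> + pi + pi) = \<gamma> \<alpha>" by (rule gamma_cong) (simp only: cis_plus_pi minus_minus)
  then show "breadth (\<alpha> + pi) = breadth \<alpha>" "breadth_deriv (\<alpha> + pi) = breadth_deriv \<alpha>"
    using height_opposite[of \<alpha>] shadow_opposite[of \<alpha>]
    by (simp_all add: breadth_def breadth_deriv_def height_def shadow_def)
qed

lemma breadth_cong: "cis \<alpha> = cis \<beta> \<Longrightarrow> breadth \<alpha> = breadth \<beta>"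
  unfolding breadth_def by (rule height_cong) (simp_all add: cis_plus_pi)

lemma breadth_has_deriv: "(breadth has_real_derivative breadth_deriv \<alpha>) (at \<alpha>)"
  and breadth_deriv_has_deriv:
    "(breadth_deriv has_real_derivative \<rho> \<alpha> + \<rho> (\<alpha> + pi) - breadth \<alpha>) (at \<alpha>)"
proof -
  have "((\<lambda>\<alpha>. \<alpha> + pi) has_vector_derivative 1) (at \<alpha>)"
    by (auto intro!: derivative_eq_intros)
  from has_vector_derivative_diff[OF vector_diff_chain_at[OF this deriv] deriv]
  have "((\<lambda>\<alpha>. \<gamma> (\<alpha> + pi) - \<gamma> \<alpha>) has_vector_derivative of_real (- (\<rho> (\<alpha> + pi) + \<rho> \<alpha>)) * cis \<alpha>) (at \<alpha>)"
    unfolding o_def cis_plus_pi by (rule has_vector_derivative_eq_rhs) (simp add: algebra_simps)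
  note rotating_frame_derivatives[OF this]
  then show "(breadth has_real_derivative breadth_deriv \<alpha>) (at \<alpha>)"
    "(breadth_deriv has_real_derivative \<rho> \<alpha> + \<rho> (\<alpha> + pi) - breadth \<alpha>) (at \<alpha>)"
    using DERIV_minus by (fastforce simp: breadth_eq[abs_def] breadth_deriv_def[abs_def] shadow_def)+
qed

lemma continuous_breadth: "continuous_on S breadth"
  by (rule DERIV_continuous_on[OF has_field_derivative_at_within[OF breadth_has_deriv]])

lemma abs_breadth_deriv_le: "\<bar>breadth_deriv \<alpha>\<bar> \<le> 2 * M"
proof -
  have "\<bar>breadth_deriv \<alpha>\<bar> \<le> cmod (cis \<alpha>) * cmod (\<gamma> (\<alpha> + pi) - \<gamma> \<alpha>)"
    unfolding breadth_deriv_def shadow_def abs_minus_cancel by (rule Cauchy_Schwarz_ineq2)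
  then show ?thesis using cmod_body_diff[OF gamma_in_body, of "\<alpha> + pi" \<alpha>] by simp
qed

lemma breadth_lipschitz: "\<bar>breadth \<alpha> - breadth \<beta>\<bar> \<le> 2 * M * cmod (cis \<alpha> - cis \<beta>)"
proof -
  have "breadth \<alpha> - breadth \<beta> \<le> 2 * M * cmod (cis \<alpha> - cis \<beta>)" for \<alpha> \<beta>
  proof -
    have "cross2 (cis \<beta>) (\<gamma> (\<alpha> + pi) - \<gamma> \<alpha>) \<le> breadth \<beta>"
      using height_nonneg[of \<beta> \<alpha>] height_nonneg[of "\<beta> + pi" "\<alpha> + pi"]
      by (simp add: breadth_eq height_def cis_plus_pi cross2_linear)
    then have "breadth \<alpha> - breadth \<beta> \<le> cross2 (cis \<alpha> - cis \<beta>) (\<gamma> (\<alpha> + pi) - \<gamma> \<alpha>)"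
      by (simp add: breadth_eq cross2_linear)
    also have "\<dots> \<le> cmod (cis \<alpha> - cis \<beta>) * cmod (\<gamma> (\<alpha> + pi) - \<gamma> \<alpha>)"
      using abs_cross2_le abs_le_D1 by blast
    also have "\<dots> \<le> cmod (cis \<alpha> - cis \<beta>) * (2 * M)"
      by (intro mult_left_mono cmod_body_diff gamma_in_body) simp
    finally show ?thesis by (simp add: mult.commute)
  qed
  from this[of \<alpha> \<beta>] this[of \<beta> \<alpha>] show ?thesis by (simp add: abs_le_iff norm_minus_commute)
qed

end

lemma (in oval_chart) width_eq_breadth: "width c L \<alpha> = breadth \<alpha>"
proof -
  have inner: "x \<bullet> (\<i> * cis \<alpha>) = cross2 (cis \<alpha>) x" for x
    by (simp add: cross2_eq_inner inner_commute)
  have lower: "cross2 (cis \<alpha>) (\<gamma> \<alpha>) \<le> cross2 (cis \<alpha>) x"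
    and upper: "cross2 (cis \<alpha>) x \<le> cross2 (cis \<alpha>) (\<gamma> (\<alpha> + pi))" if "x \<in> body" for x
    using body_in_halfplane[OF that, of \<alpha>] body_in_halfplane[OF that, of "\<alpha> + pi"]
    by (simp_all add: cis_plus_pi cross2_linear)
  have "(SUP x\<in>body. cross2 (cis \<alpha>) x) = cross2 (cis \<alpha>) (\<gamma> (\<alpha> + pi))"
    using gamma_in_body upper by (intro cSup_eq_maximum) auto
  moreover have "(INF x\<in>body. cross2 (cis \<alpha>) x) = cross2 (cis \<alpha>) (\<gamma> \<alpha>)"
    using gamma_in_body lower by (intro cInf_eq_minimum) auto
  ultimately show ?thesis
    by (simp add: width_def domain_eq inner breadth_eq cross2_linear)
qed

section \<open>Circles inscribed in an angle and lines tangent to a circle\<close>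

lemma cis_basis:
  assumes "sin (\<theta> - \<phi>) \<noteq> 0"
  shows "z = of_real (cross2 (cis \<phi>) z / sin (\<theta> - \<phi>)) * cis \<theta> - of_real (cross2 (cis \<theta>) z / sin (\<theta> - \<phi>)) * cis \<phi>"
proof -
  have "of_real (cross2 (cis \<phi>) (cis \<theta>)) * z
      = of_real (cross2 (cis \<phi>) z) * cis \<theta> - of_real (cross2 (cis \<theta>) z) * cis \<phi>"
    by (simp add: cross2_expand complex_eq_iff algebra_simps)
  then show ?thesis using assms by (simp add: cross2_cis field_simps del: of_real_diff)
qed

lemma angle_region_eq:
  assumes sin: "0 < sin (\<theta> - \<phi>)" and a: "0 < a" and p: "0 < p"
  shows "angle_region A (of_real a * cis \<theta>) (of_real p * cis \<phi>)
    = {x. cross2 (cis \<theta>) (x - A) \<le> 0 \<and> 0 \<le> cross2 (cis \<phi>) (x - A)}"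
proof (intro set_eqI iffI)
  fix x assume "x \<in> angle_region A (of_real a * cis \<theta>) (of_real p * cis \<phi>)"
  then obtain s t where st: "s \<ge> 0" "t \<ge> 0"
    and "x = A + of_real s * (of_real a * cis \<theta>) + of_real t * (of_real p * cis \<phi>)"
    unfolding angle_region_def by blast
  then have x: "x - A = of_real (s * a) * cis \<theta> + of_real (t * p) * cis \<phi>" by simp
  have "sin (\<phi> - \<theta>) = - sin (\<theta> - \<phi>)" using sin_minus[of "\<theta> - \<phi>"] by simp
  then show "x \<in> {x. cross2 (cis \<theta>) (x - A) \<le> 0 \<and> 0 \<le> cross2 (cis \<phi>) (x - A)}"
    unfolding mem_Collect_eq x using st a p sin by (simp add: cross2_linear cross2_cis del: of_real_mult)
next
  fix x assume x: "x \<in> {x. cross2 (cis \<theta>) (x - A) \<le> 0 \<and> 0 \<le> cross2 (cis \<phi>) (x - A)}"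
  define s where "s = cross2 (cis \<phi>) (x - A) / sin (\<theta> - \<phi>) / a"
  define t where "t = - cross2 (cis \<theta>) (x - A) / sin (\<theta> - \<phi>) / p"
  have "s \<ge> 0" "t \<ge> 0" using x a p sin by (simp_all add: s_def t_def divide_nonpos_pos)
  moreover have "x - A = of_real (s * a) * cis \<theta> + of_real (t * p) * cis \<phi>"
    using cis_basis[of \<theta> \<phi> "x - A"] sin a p by (simp add: s_def t_def)
  then have "x = A + of_real s * (of_real a * cis \<theta>) + of_real t * (of_real p * cis \<phi>)"
    by (simp add: algebra_simps)
  ultimately show "x \<in> angle_region A (of_real a * cis \<theta>) (of_real p * cis \<phi>)"
    unfolding angle_region_def by blast
qed

lemma cball_subset_halfplane_iff:
  assumes "0 \<le> r"
  shows "cball Z r \<subseteq> {x. 0 \<le> cross2 (cis \<phi>) (x - A)} \<longleftrightarrow> r \<le> cross2 (cis \<phi>) (Z - A)"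
proof
  assume sub: "cball Z r \<subseteq> {x. 0 \<le> cross2 (cis \<phi>) (x - A)}"
  have "Z - of_real r * (\<i> * cis \<phi>) \<in> cball Z r"
    using assms by (simp add: dist_norm norm_mult)
  then have "0 \<le> cross2 (cis \<phi>) (Z - of_real r * (\<i> * cis \<phi>) - A)" using sub by blast
  also have "\<dots> = cross2 (cis \<phi>) (Z - A) - r"
    unfolding cross2_linear cross2_cis_i_cis by simp
  finally show "r \<le> cross2 (cis \<phi>) (Z - A)" by simp
next
  assume le: "r \<le> cross2 (cis \<phi>) (Z - A)"
  have "0 \<le> cross2 (cis \<phi>) (x - A)" if "x \<in> cball Z r" for x
  proof -
    have "\<bar>cross2 (cis \<phi>) (Z - x)\<bar> \<le> r"
      using abs_cross2_le[of "cis \<phi>" "Z - x"] that by (simp add: dist_norm)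
    then show ?thesis using le by (simp add: cross2_linear)
  qed
  then show "cball Z r \<subseteq> {x. 0 \<le> cross2 (cis \<phi>) (x - A)}" by blast
qed

lemma cball_subset_angle_region_iff:
  assumes "0 < sin (\<theta> - \<phi>)" "0 < a" "0 < p" "0 \<le> r"
  shows "cball Z r \<subseteq> angle_region A (of_real a * cis \<theta>) (of_real p * cis \<phi>) \<longleftrightarrow>
    cross2 (cis \<theta>) (Z - A) \<le> - r \<and> r \<le> cross2 (cis \<phi>) (Z - A)"
proof -
  have "angle_region A (of_real a * cis \<theta>) (of_real p * cis \<phi>)
      = {x. 0 \<le> cross2 (cis (\<theta> + pi)) (x - A)} \<inter> {x. 0 \<le> cross2 (cis \<phi>) (x - A)}"
    unfolding angle_region_eq[OF assms(1-3)] cis_plus_pi by (auto simp: cross2_linear(6))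
  then show ?thesis
    using cball_subset_halfplane_iff[OF assms(4), of Z "\<theta> + pi" A] cball_subset_halfplane_iff[OF assms(4), of Z \<phi> A]
    by (auto simp: cis_plus_pi cross2_linear(6))
qed

lemma sphere_touching_line:
  assumes "P \<in> sphere Z r" "cross2 (cis \<theta>) (Z - P) \<le> - r"
  shows "Z = P - of_real r * (\<i> * cis \<theta>)"
proof -
  have r: "cmod (Z - P) = r" using assms(1) by (simp add: dist_norm)
  then have "\<bar>cross2 (cis \<theta>) (Z - P)\<bar> \<le> r" using abs_cross2_le[of "cis \<theta>" "Z - P"] by simp
  then have cross: "cross2 (cis \<theta>) (Z - P) = - r" using assms(2) by linarith
  then have "cis \<theta> \<bullet> (Z - P) = 0" using cmod_cis_frame[of "Z - P" \<theta>] r by simp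
  then have "Z - P = - of_real r * (\<i> * cis \<theta>)"
    using cis_frame_decomposition[of "Z - P" \<theta>] cross by simp
  then show ?thesis by (simp add: algebra_simps)
qed

lemma equal_tangent_length:
  fixes a r \<delta> :: real
  assumes "r * (1 + cos \<delta>) = a * sin \<delta>" "0 < sin \<delta>"
  shows "a * cos \<delta> + r * sin \<delta> = a"
proof -
  have "1 + cos \<delta> \<noteq> 0"
    using assms(2) sin_squared_eq[of \<delta>] by (auto simp: power2_eq_square add_eq_0_iff)
  moreover have "(1 + cos \<delta>) * (a * cos \<delta> + r * sin \<delta>) = (1 + cos \<delta>) * a"
    using assms(1) sin_cos_squared_add[of \<delta>] by algebra
  ultimately show ?thesis by simp
qed

lemma cross2_touching_center:
  "cross2 (cis \<phi>) (of_real a * cis \<theta> - of_real r * (\<i> * cis \<theta>)) = a * sin (\<theta> - \<phi>) - r * cos (\<theta> - \<phi>)"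
  by (simp add: cross2_linear(2,3) cross2_cis cross2_cis_i_cis)

lemma inscribed_touchingD:
  assumes sin: "0 < sin (\<theta> - \<phi>)" and a: "0 < a" and p: "0 < p"
    and inscribed: "inscribed_in_angle Z r A (of_real a * cis \<theta>) (of_real p * cis \<phi>)"
    and touch: "A + of_real a * cis \<theta> \<in> sphere Z r"
  shows "Z = A + of_real a * cis \<theta> - of_real r * (\<i> * cis \<theta>)" "r * (1 + cos (\<theta> - \<phi>)) = a * sin (\<theta> - \<phi>)"
proof -
  have r: "0 < r" and ray: "ray A (of_real p * cis \<phi>) \<inter> sphere Z r \<noteq> {}"
    and sides: "cross2 (cis \<theta>) (Z - A) \<le> - r" "r \<le> cross2 (cis \<phi>) (Z - A)"
    using inscribed cball_subset_angle_region_iff[OF sin a p, of r Z A] by (auto simp: inscribed_in_angle_def)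
  have "cross2 (cis \<theta>) (Z - (A + of_real a * cis \<theta>)) = cross2 (cis \<theta>) (Z - A)"
    by (simp add: cross2_linear cross2_cis)
  then show Z: "Z = A + of_real a * cis \<theta> - of_real r * (\<i> * cis \<theta>)"
    using touch sides(1) by (intro sphere_touching_line) simp_all
  obtain y t where y: "y \<in> sphere Z r" "y = A + of_real t * (of_real p * cis \<phi>)"
    using ray unfolding ray_def by blast
  then have "cross2 (cis \<phi>) (Z - A) = cross2 (cis \<phi>) (Z - y)"
    by (simp add: cross2_linear cross2_cis)
  then have "cross2 (cis \<phi>) (Z - A) \<le> r"
    using abs_cross2_le[of "cis \<phi>" "Z - y"] y(1) by (simp add: dist_norm)
  then have "cross2 (cis \<phi>) (Z - A) = r" using sides(2) by simp
  then show "r * (1 + cos (\<theta> - \<phi>)) = a * sin (\<theta> - \<phi>)"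
    using cross2_touching_center[of \<phi> a \<theta> r] by (simp add: Z algebra_simps)
qed

lemma inscribed_touchingI:
  assumes sin: "0 < sin (\<theta> - \<phi>)" and a: "0 < a" and p: "0 < p"
    and tangent: "r * (1 + cos (\<theta> - \<phi>)) = a * sin (\<theta> - \<phi>)"
    and center: "Z - A = of_real a * cis \<theta> - of_real r * (\<i> * cis \<theta>)"
  shows "inscribed_in_angle Z r A (of_real a * cis \<theta>) (of_real p * cis \<phi>)" "A + of_real a * cis \<theta> \<in> sphere Z r"
proof -
  have "0 \<le> 1 + cos (\<theta> - \<phi>)" using cos_ge_minus_one[of "\<theta> - \<phi>"] by linarith
  moreover have "0 < r * (1 + cos (\<theta> - \<phi>))" using tangent a sin by simp
  ultimately have r: "0 < r" by (simp add: zero_less_mult_iff)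
  have cross: "cross2 (cis \<theta>) (Z - A) = - r" "cross2 (cis \<phi>) (Z - A) = r"
    unfolding center cross2_touching_center using tangent by (simp_all add: algebra_simps)
  have "cis \<phi> \<bullet> (Z - A) = a * cos (\<theta> - \<phi>) + r * sin (\<theta> - \<phi>)"
    by (simp add: center inner_complex_def cos_diff sin_diff algebra_simps)
  also have "\<dots> = a" using tangent sin by (rule equal_tangent_length)
  finally have "Z - (A + of_real a * cis \<phi>) = of_real r * (\<i> * cis \<phi>)"
    using cis_frame_decomposition[of "Z - A" \<phi>] cross(2) by (simp add: algebra_simps)
  then have touch: "A + of_real a * cis \<phi> \<in> sphere Z r"
    unfolding mem_sphere dist_norm using r by (simp add: norm_mult)
  have "Z - (A + of_real a * cis \<theta>) = - (of_real r * (\<i> * cis \<theta>))" using center by (simp add: algebra_simps)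
  then show P: "A + of_real a * cis \<theta> \<in> sphere Z r"
    unfolding mem_sphere dist_norm using r by (simp add: norm_mult)
  have ray: "A + of_real a * cis s \<in> ray A (of_real k * cis s)" if "0 < k" for k s
    unfolding ray_def using that a by (intro CollectI exI[of _ "a / k"]) simp
  show "inscribed_in_angle Z r A (of_real a * cis \<theta>) (of_real p * cis \<phi>)"
    unfolding inscribed_in_angle_def cball_subset_angle_region_iff[OF sin a p less_imp_le[OF r]] cross
    using r ray[OF a, of \<theta>] ray[OF p, of \<phi>] P touch by blast
qed

lemma line_eq_range: "line q u = range (\<lambda>x. q + of_real x * u)"
  by (auto simp: line_def)

lemma in_line_cis_iff: "p \<in> line q (cis s) \<longleftrightarrow> cross2 (cis s) (p - q) = 0"
proof
  assume "cross2 (cis s) (p - q) = 0"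
  then have "p = q + of_real (cis s \<bullet> (p - q)) * cis s"
    using cis_frame_decomposition[of "p - q" s] by (simp add: algebra_simps)
  then show "p \<in> line q (cis s)" unfolding line_def by blast
qed (auto simp: line_def cross2_linear cross2_cis)

lemma line_eq_line_cis:
  assumes "p \<in> line q (cis s)" "k \<noteq> 0"
  shows "line p (of_real k * cis s) = line q (cis s)"
proof -
  obtain y where p: "p = q + of_real y * cis s" using assms(1) by (auto simp: line_def)
  have "surj (\<lambda>x. y + x * k)" by (rule surjI[of _ "\<lambda>z. (z - y) / k"]) (use assms(2) in simp)
  moreover have "line p (of_real k * cis s) = (\<lambda>x. q + of_real x * cis s) ` range (\<lambda>x. y + x * k)"
    unfolding line_eq_range image_image p by (simp add: algebra_simps)
  ultimately show ?thesis by (simp add: line_eq_range)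
qed

lemma ex1_power2_eq_iff:
  fixes h k :: real
  shows "(\<exists>!x. (x - h)\<^sup>2 = k) \<longleftrightarrow> k = 0"
proof
  assume "\<exists>!x. (x - h)\<^sup>2 = k"
  then obtain x where x: "(x - h)\<^sup>2 = k" and unique: "\<And>y. (y - h)\<^sup>2 = k \<Longrightarrow> y = x" by blast
  have "(2 * h - x - h)\<^sup>2 = k" using x by (simp add: power2_eq_square algebra_simps)
  then have "2 * h - x = x" by (rule unique)
  then show "k = 0" using x by simp
qed auto

lemma ex1_in_range_iff:
  assumes "inj f"
  shows "(\<exists>!y. y \<in> range f \<inter> S) \<longleftrightarrow> (\<exists>!x. f x \<in> S)"
proof
  assume "\<exists>!y. y \<in> range f \<inter> S"
  then obtain x where "f x \<in> S" and "\<And>x'. f x' \<in> S \<Longrightarrow> f x' = f x" by blast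
  then show "\<exists>!x. f x \<in> S" using injD[OF assms] by blast
next
  assume "\<exists>!x. f x \<in> S"
  then show "\<exists>!y. y \<in> range f \<inter> S" by blast
qed

lemma line_tangent_to_circle_iff:
  assumes "R > 0"
  shows "(\<exists>!p. p \<in> line q (cis s) \<inter> sphere Z R) \<longleftrightarrow> \<bar>cross2 (cis s) (Z - q)\<bar> = R"
proof -
  define h where "h = cis s \<bullet> (Z - q)"
  define d where "d = cross2 (cis s) (Z - q)"
  have "(dist Z (q + of_real x * cis s))\<^sup>2 = (x - h)\<^sup>2 + d\<^sup>2" for x
  proof -
    have "cis s \<bullet> (Z - (q + of_real x * cis s)) = h - x"
      by (simp add: h_def inner_complex_def algebra_simps del: sin_cos_squared_add3)
        (simp flip: distrib_left)
    moreover have "cross2 (cis s) (Z - (q + of_real x * cis s)) = d"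
      by (simp add: d_def cross2_linear cross2_cis)
    ultimately show ?thesis
      unfolding dist_norm cmod_cis_frame[of _ s] by (simp add: power2_commute)
  qed
  then have on_sphere: "q + of_real x * cis s \<in> sphere Z R \<longleftrightarrow> (x - h)\<^sup>2 = R\<^sup>2 - d\<^sup>2" for x
    using assms unfolding mem_sphere by (metis power2_eq_iff_nonneg zero_le_dist less_imp_le eq_diff_eq)
  have "inj (\<lambda>x. q + of_real x * cis s)" by (auto simp: inj_def)
  then have "(\<exists>!p. p \<in> line q (cis s) \<inter> sphere Z R) \<longleftrightarrow> (\<exists>!x. (x - h)\<^sup>2 = R\<^sup>2 - d\<^sup>2)"
    unfolding line_eq_range by (subst ex1_in_range_iff) (simp_all only: on_sphere)
  also have "\<dots> \<longleftrightarrow> \<bar>d\<bar> = R"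
    unfolding ex1_power2_eq_iff using assms power2_eq_iff_nonneg[of "\<bar>d\<bar>" R] by auto
  finally show ?thesis by (simp add: d_def)
qed

section \<open>Exterior points and their tangent lines\<close>

definition exterior_pair :: "real \<Rightarrow> real \<Rightarrow> bool" where
  "exterior_pair \<phi> \<theta> \<longleftrightarrow> \<phi> < \<theta> \<and> \<theta> < \<phi> + pi"

lemma exterior_pair_sin_pos: "exterior_pair \<phi> \<theta> \<Longrightarrow> 0 < sin (\<theta> - \<phi>)"
  by (rule sin_gt_zero) (auto simp: exterior_pair_def)

lemma one_plus_cos_pos: "\<bar>x\<bar> < pi \<Longrightarrow> 0 < 1 + cos x"
  using cos_monotone_0_pi[of "\<bar>x\<bar>" pi] by simp

lemma exterior_pair_cos_pos: "exterior_pair \<phi> \<theta> \<Longrightarrow> 0 < 1 + cos (\<theta> - \<phi>)"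
  by (rule one_plus_cos_pos) (auto simp: exterior_pair_def)

lemma exterior_pair_cis_neq: "exterior_pair \<phi> \<theta> \<Longrightarrow> cis \<phi> \<noteq> cis \<theta>"
  using cis_inj_near[of \<phi> \<theta>] by (auto simp: exterior_pair_def)

context angle_curve
begin

lemma exterior_pair_height_pos:
  assumes "exterior_pair \<phi> \<theta>"
  shows "0 < height \<phi> \<theta>" "0 < height \<theta> \<phi>"
  using exterior_pair_cis_neq[OF assms] height_pos by metis+

definition tangent_line :: "real \<Rightarrow> complex set" where
  "tangent_line s = line (\<gamma> s) (cis s)"

lemma in_tangent_line_iff: "p \<in> tangent_line s \<longleftrightarrow> cross2 (cis s) (p - \<gamma> s) = 0"
  by (simp add: tangent_line_def in_line_cis_iff)

lemma tangent_line_eq_iff: "tangent_line s = tangent_line t \<longleftrightarrow> cis s = cis t"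
proof
  assume eq: "tangent_line s = tangent_line t"
  have "\<gamma> t \<in> tangent_line t" by (simp add: in_tangent_line_iff cross2_def)
  then have "height s t = 0" unfolding eq[symmetric] by (simp add: in_tangent_line_iff height_def)
  then show "cis s = cis t" using height_pos[of t s] by (metis less_irrefl)
qed (simp add: tangent_line_def gamma_cong[of s t])

definition len_pos :: "real \<Rightarrow> real \<Rightarrow> real" where
  "len_pos \<phi> \<theta> = height \<phi> \<theta> / sin (\<theta> - \<phi>)"

definition len_neg :: "real \<Rightarrow> real \<Rightarrow> real" where
  "len_neg \<phi> \<theta> = height \<theta> \<phi> / sin (\<theta> - \<phi>)"

text \<open>The exterior point whose negative and positive tangency points are \<open>\<gamma> \<phi>\<close> and \<open>\<gamma> \<theta>\<close>.\<close>

definition vertex :: "real \<Rightarrow> real \<Rightarrow> complex" where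
  "vertex \<phi> \<theta> = \<gamma> \<theta> - of_real (len_pos \<phi> \<theta>) * cis \<theta>"

lemma len_pos_pos: "exterior_pair \<phi> \<theta> \<Longrightarrow> 0 < len_pos \<phi> \<theta>"
  and len_neg_pos: "exterior_pair \<phi> \<theta> \<Longrightarrow> 0 < len_neg \<phi> \<theta>"
  using exterior_pair_sin_pos exterior_pair_height_pos by (simp_all add: len_pos_def len_neg_def)

lemma vertex_eq_neg:
  assumes "exterior_pair \<phi> \<theta>"
  shows "vertex \<phi> \<theta> = \<gamma> \<phi> + of_real (len_neg \<phi> \<theta>) * cis \<phi>"
proof -
  have "cross2 (cis \<theta>) (\<gamma> \<theta> - \<gamma> \<phi>) = - height \<theta> \<phi>" by (simp add: height_def cross2_linear)
  then have "\<gamma> \<theta> - \<gamma> \<phi> = of_real (len_pos \<phi> \<theta>) * cis \<theta> + of_real (len_neg \<phi> \<theta>) * cis \<phi>"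
    using cis_basis[of \<theta> \<phi> "\<gamma> \<theta> - \<gamma> \<phi>"] exterior_pair_sin_pos[OF assms]
    by (simp add: len_pos_def len_neg_def height_def)
  then show ?thesis by (simp add: vertex_def algebra_simps)
qed

lemma tangent_lines_meet:
  assumes "exterior_pair \<phi> \<theta>"
  shows "tangent_line \<phi> \<inter> tangent_line \<theta> = {vertex \<phi> \<theta>}"
proof -
  have mem: "vertex \<phi> \<theta> \<in> tangent_line \<phi>" "vertex \<phi> \<theta> \<in> tangent_line \<theta>"
    unfolding in_tangent_line_iff
    by (simp add: vertex_eq_neg[OF assms] cross2_linear cross2_cis)
      (simp add: vertex_def cross2_linear cross2_cis)
  have "p = vertex \<phi> \<theta>" if "p \<in> tangent_line \<phi>" "p \<in> tangent_line \<theta>" for p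
  proof -
    have "cross2 (cis \<phi>) (p - vertex \<phi> \<theta>) = 0" "cross2 (cis \<theta>) (p - vertex \<phi> \<theta>) = 0"
      using that mem by (simp_all add: in_tangent_line_iff cross2_linear)
    then have "p - vertex \<phi> \<theta> = 0"
      using cis_basis[of \<theta> \<phi> "p - vertex \<phi> \<theta>"] exterior_pair_sin_pos[OF assms] by simp
    then show ?thesis by simp
  qed
  then show ?thesis using mem by blast
qed

lemma exterior_point_separated:
  assumes "A \<notin> body"
  obtains s where "cross2 (cis s) (A - \<gamma> s) < 0"
proof -
  obtain a b where ab: "a \<bullet> A < b" "\<And>x. x \<in> body \<Longrightarrow> a \<bullet> x > b"
    using separating_hyperplane_closed_point[OF convex_convex_hull compact_imp_closed[OF compact_body] assms]
    by blast
  define s where "s = Arg a - pi / 2"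
  have "a = of_real (cmod a) * cis (Arg a)" using rcis_cmod_Arg[of a] by (simp add: rcis_def)
  also have "cis (Arg a) = \<i> * cis s" by (simp add: s_def complex_eq_iff cos_diff sin_diff)
  finally have a: "a = of_real (cmod a) * (\<i> * cis s)" .
  have "a \<bullet> (A - \<gamma> s) < 0" using ab(1) ab(2)[OF gamma_in_body[of s]] by (simp add: inner_diff_right)
  also have "a \<bullet> (A - \<gamma> s) = cmod a * cross2 (cis s) (A - \<gamma> s)"
    by (subst a) (simp add: cross2_expand inner_complex_def algebra_simps)
  finally have "cross2 (cis s) (A - \<gamma> s) < 0"
    by (metis mult_less_0_iff norm_ge_zero not_less)
  then show ?thesis using that by blast
qed

lemma exterior_point_on_tangent_lines:
  assumes "A \<notin> body"
  obtains \<phi> s \<theta> where "s - pi < \<phi>" "\<phi> < s" "s < \<theta>" "\<theta> < s + pi"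
    "A \<in> tangent_line \<phi>" "A \<in> tangent_line \<theta>" "cross2 (cis s) (A - \<gamma> s) < 0"
proof -
  define f where "f = (\<lambda>x. cross2 (cis x) (A - \<gamma> x))"
  obtain s where s: "f s < 0" using exterior_point_separated[OF assms] f_def by blast
  have cont: "continuous_on S f" for S
    unfolding f_def cross2_def by (intro continuous_intros continuous_gamma)
  have "f (s + pi) = breadth s - f s" "f (s - pi) = breadth s - f s"
    by (simp_all add: f_def breadth_eq cis_plus_pi cis_minus_pi gamma_minus_pi cross2_linear)
  then have opposite: "0 < f (s + pi)" "0 < f (s - pi)" using s breadth_pos[of s] by auto
  obtain \<theta> where \<theta>: "s \<le> \<theta>" "\<theta> \<le> s + pi" "f \<theta> = 0"
    using IVT'[of f s 0 "s + pi"] s opposite cont by auto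
  obtain \<phi> where \<phi>: "s - pi \<le> \<phi>" "\<phi> \<le> s" "f \<phi> = 0"
    using IVT2'[of f s 0 "s - pi"] s opposite cont by auto
  have "s < \<theta>" "\<theta> < s + pi" "\<phi> < s" "s - pi < \<phi>"
    using \<theta> \<phi> s opposite by (metis less_irrefl order_less_le)+
  then show ?thesis using that \<theta>(3) \<phi>(3) s by (simp add: in_tangent_line_iff f_def)
qed

lemma exterior_point_is_vertex:
  assumes "A \<notin> body"
  obtains \<phi> \<theta> where "exterior_pair \<phi> \<theta>" "A = vertex \<phi> \<theta>"
proof -
  obtain \<phi> s \<theta> where order: "s - pi < \<phi>" "\<phi> < s" "s < \<theta>" "\<theta> < s + pi"
    and lines: "A \<in> tangent_line \<phi>" "A \<in> tangent_line \<theta>" and s: "cross2 (cis s) (A - \<gamma> s) < 0"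
    using exterior_point_on_tangent_lines[OF assms] by blast
  obtain k where k: "A = \<gamma> \<theta> + of_real k * cis \<theta>"
    using lines(2) by (auto simp: tangent_line_def line_def)
  have side: "cross2 (cis x) (A - \<gamma> x) = height x \<theta> + k * sin (\<theta> - x)" for x
    by (simp add: k height_def cross2_linear cross2_cis)
  have "k * sin (\<theta> - s) < 0" using s side[of s] height_nonneg[of s \<theta>] by linarith
  moreover have "0 < sin (\<theta> - s)" using order by (intro sin_gt_zero) auto
  ultimately have "k < 0" by (simp add: mult_less_0_iff)
  have "0 < height \<phi> \<theta>" using order by (intro height_pos_near) auto
  then have "k * sin (\<theta> - \<phi>) < 0" using side[of \<phi>] lines(1) by (simp add: in_tangent_line_iff)
  then have "0 < sin (\<theta> - \<phi>)" using \<open>k < 0\<close> by (simp add: mult_less_0_iff)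
  moreover have "sin (\<theta> - \<phi>) \<le> 0" if "\<phi> + pi \<le> \<theta>" using that order by (intro sin_le_zero) auto
  ultimately have "exterior_pair \<phi> \<theta>" using order by (fastforce simp: exterior_pair_def)
  then show ?thesis using that lines tangent_lines_meet by blast
qed

lemma tangency_point_unique:
  assumes s: "\<gamma> s - A = of_real k * cis s" and t: "\<gamma> t - A = of_real l * cis t" and kl: "0 < k * l"
  shows "\<gamma> s = \<gamma> t"
proof (rule ccontr)
  assume "\<gamma> s \<noteq> \<gamma> t"
  then have "cis s \<noteq> cis t" using gamma_cong by blast
  then have "0 < height s t" "0 < height t s" using height_pos by metis+
  moreover have "\<gamma> t - \<gamma> s = of_real l * cis t - of_real k * cis s"
    "\<gamma> s - \<gamma> t = of_real k * cis s - of_real l * cis t"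
    using s t by (simp_all add: algebra_simps)
  ultimately have "0 < l * sin (t - s)" "0 < k * sin (s - t)"
    by (simp_all add: height_def cross2_linear(2,3) cross2_cis)
  moreover have "sin (s - t) = - sin (t - s)" using sin_minus[of "t - s"] by simp
  ultimately show False using kl by (auto simp: zero_less_mult_iff mult_less_0_iff)
qed

section \<open>The auxiliary circle\<close>

text \<open>The radius of the circle that touches the curve externally at \<open>\<gamma> \<theta>\<close> and is also tangent to the
  tangent line at \<open>\<gamma> \<psi>\<close>.\<close>

definition radius :: "real \<Rightarrow> real \<Rightarrow> real" where
  "radius \<theta> \<psi> = height \<psi> \<theta> / (1 + cos (\<psi> - \<theta>))"

definition touching_center :: "real \<Rightarrow> real \<Rightarrow> complex" where
  "touching_center \<theta> R = \<gamma> \<theta> - of_real R * (\<i> * cis \<theta>)"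

lemma radius_eq_iff:
  assumes "\<bar>\<psi> - \<theta>\<bar> < pi"
  shows "radius \<theta> \<psi> = R \<longleftrightarrow> height \<psi> \<theta> = R * (1 + cos (\<psi> - \<theta>))"
  using one_plus_cos_pos[OF assms] by (auto simp: radius_def field_simps)

lemma radius_pos:
  assumes "exterior_pair \<phi> \<theta>"
  shows "0 < radius \<theta> \<phi>"
  using exterior_pair_height_pos(1)[OF assms] exterior_pair_cos_pos[OF assms] cos_minus[of "\<theta> - \<phi>"]
  by (simp add: radius_def)

lemma chord_inner_pos:
  assumes "exterior_pair a b"
  shows "0 < cis ((a + b) / 2) \<bullet> (\<gamma> b - \<gamma> a)"
proof -
  define \<mu> where "\<mu> = (a + b) / 2"
  have ab: "a < b" "b < a + pi" using assms by (auto simp: exterior_pair_def)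
  have "cis \<mu> \<bullet> \<gamma> a < cis \<mu> \<bullet> \<gamma> b"
  proof (rule DERIV_pos_imp_increasing[OF ab(1)])
    fix x assume "a \<le> x" "x \<le> b"
    then have "0 < cos (x - \<mu>)"
      using ab by (intro cos_gt_zero_pi) (auto simp: \<mu>_def field_simps)
    moreover have "cis \<mu> \<bullet> (of_real (\<rho> x) * cis x) = \<rho> x * cos (x - \<mu>)"
      by (simp add: inner_complex_def cos_diff algebra_simps)
    then have "((\<lambda>x. cis \<mu> \<bullet> \<gamma> x) has_real_derivative \<rho> x * cos (x - \<mu>)) (at x)"
      using bounded_linear.has_vector_derivative[OF bounded_linear_inner_right deriv[of x], of "cis \<mu>"]
      by (simp add: has_real_derivative_iff_has_vector_derivative)
    ultimately show "\<exists>y. ((\<lambda>x. cis \<mu> \<bullet> \<gamma> x) has_real_derivative y) (at x) \<and> 0 < y"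
      using rho_pos mult_pos_pos by blast
  qed
  then show ?thesis by (simp add: \<mu>_def inner_diff_right)
qed

lemma radius_deriv:
  assumes "\<bar>\<psi> - \<theta>\<bar> < pi"
  shows "(radius \<theta> has_real_derivative
    2 * cos ((\<psi> - \<theta>) / 2) / (1 + cos (\<psi> - \<theta>))\<^sup>2 * (cis ((\<psi> + \<theta>) / 2) \<bullet> (\<gamma> \<psi> - \<gamma> \<theta>))) (at \<psi>)"
proof -
  define x where "x = (\<psi> - \<theta>) / 2"
  have midpoint: "\<psi> - x = (\<psi> + \<theta>) / 2" by (simp add: x_def field_simps)
  have "1 + cos (\<psi> - \<theta>) \<noteq> 0" using one_plus_cos_pos[OF assms] by simp
  then have "(radius \<theta> has_real_derivative
      (- shadow \<psi> \<theta> * (1 + cos (\<psi> - \<theta>)) + height \<psi> \<theta> * sin (\<psi> - \<theta>)) / (1 + cos (\<psi> - \<theta>))\<^sup>2) (at \<psi>)"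
    unfolding radius_def[abs_def]
    by (auto intro!: derivative_eq_intros height_base_deriv simp: power2_eq_square)
  moreover have "- shadow \<psi> \<theta> * (1 + cos (\<psi> - \<theta>)) + height \<psi> \<theta> * sin (\<psi> - \<theta>)
      = 2 * cos x * (cis (\<psi> - x) \<bullet> (\<gamma> \<psi> - \<gamma> \<theta>))"
  proof -
    have "\<psi> - \<theta> = 2 * x" by (simp add: x_def)
    then have "1 + cos (\<psi> - \<theta>) = 2 * cos x * cos x" "sin (\<psi> - \<theta>) = 2 * cos x * sin x"
      by (simp_all only: cos_double_cos sin_double power2_eq_square) simp_all
    moreover have "cis (\<psi> - x) \<bullet> (\<gamma> \<psi> - \<gamma> \<theta>) = - shadow \<psi> \<theta> * cos x + height \<psi> \<theta> * sin x"
      by (simp add: shadow_def height_def cross2_expand inner_complex_def cos_diff sin_diff algebra_simps)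
    ultimately show ?thesis by (simp only:) (simp add: algebra_simps)
  qed
  ultimately show ?thesis unfolding midpoint unfolding x_def by simp
qed

lemma radius_deriv_sign:
  assumes "\<bar>\<psi> - \<theta>\<bar> < pi"
  obtains y where "(radius \<theta> has_real_derivative y) (at \<psi>)" "\<theta> < \<psi> \<Longrightarrow> 0 < y" "\<psi> < \<theta> \<Longrightarrow> y < 0"
proof
  let ?k = "2 * cos ((\<psi> - \<theta>) / 2) / (1 + cos (\<psi> - \<theta>))\<^sup>2"
  have "0 < cos ((\<psi> - \<theta>) / 2)" using assms by (intro cos_gt_zero_pi) (auto simp: abs_if split: if_splits)
  then have k: "0 < ?k" using one_plus_cos_pos[OF assms] by simp
  show "(radius \<theta> has_real_derivative ?k * (cis ((\<psi> + \<theta>) / 2) \<bullet> (\<gamma> \<psi> - \<gamma> \<theta>))) (at \<psi>)"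
    by (rule radius_deriv[OF assms])
  show "0 < ?k * (cis ((\<psi> + \<theta>) / 2) \<bullet> (\<gamma> \<psi> - \<gamma> \<theta>))" if "\<theta> < \<psi>"
  proof (rule mult_pos_pos[OF k])
    show "0 < cis ((\<psi> + \<theta>) / 2) \<bullet> (\<gamma> \<psi> - \<gamma> \<theta>)"
      using chord_inner_pos[of \<theta> \<psi>] that assms by (simp add: exterior_pair_def add.commute)
  qed
  show "?k * (cis ((\<psi> + \<theta>) / 2) \<bullet> (\<gamma> \<psi> - \<gamma> \<theta>)) < 0" if "\<psi> < \<theta>"
  proof (rule mult_pos_neg[OF k])
    show "cis ((\<psi> + \<theta>) / 2) \<bullet> (\<gamma> \<psi> - \<gamma> \<theta>) < 0"
      using chord_inner_pos[of \<psi> \<theta>] that assms by (simp add: exterior_pair_def inner_diff_right)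
  qed
qed

lemma inj_on_radius: "inj_on (radius \<theta>) {\<theta><..<\<theta> + pi}" "inj_on (radius \<theta>) {\<theta> - pi<..<\<theta>}"
proof -
  have "radius \<theta> a < radius \<theta> b" if "\<theta> < a" "a < b" "b < \<theta> + pi" for a b
  proof (rule DERIV_pos_imp_increasing[OF that(2)])
    fix x assume "a \<le> x" "x \<le> b"
    then have "\<bar>x - \<theta>\<bar> < pi" "\<theta> < x" using that by auto
    then show "\<exists>y. (radius \<theta> has_real_derivative y) (at x) \<and> 0 < y" using radius_deriv_sign by metis
  qed
  then show "inj_on (radius \<theta>) {\<theta><..<\<theta> + pi}"
    by (intro linorder_inj_onI') (auto dest: less_imp_neq)
  have "radius \<theta> b < radius \<theta> a" if "\<theta> - pi < a" "a < b" "b < \<theta>" for a b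
  proof (rule DERIV_neg_imp_decreasing[OF that(2)])
    fix x assume "a \<le> x" "x \<le> b"
    then have "\<bar>x - \<theta>\<bar> < pi" "x < \<theta>" using that by auto
    then show "\<exists>y. (radius \<theta> has_real_derivative y) (at x) \<and> y < 0" using radius_deriv_sign by metis
  qed
  then show "inj_on (radius \<theta>) {\<theta> - pi<..<\<theta>}"
    by (intro linorder_inj_onI') (force dest: less_imp_neq)
qed

lemma radius_attained:
  assumes "0 < R"
  obtains \<psi> where "exterior_pair \<theta> \<psi>" "radius \<theta> \<psi> = R"
proof -
  define e where "e = (\<lambda>\<psi>. height \<psi> \<theta> - R * (1 + cos (\<psi> - \<theta>)))"
  have cont: "continuous_on S e" for S
    unfolding e_def
    by (intro continuous_intros DERIV_continuous_on[OF has_field_derivative_at_within[OF height_base_deriv]])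
  have ends: "e \<theta> < 0" "0 < e (\<theta> + pi)"
    using assms by (simp_all add: e_def height_self height_opposite breadth_pos)
  obtain \<psi> where \<psi>: "\<theta> \<le> \<psi>" "\<psi> \<le> \<theta> + pi" "e \<psi> = 0"
    using IVT'[of e \<theta> 0 "\<theta> + pi"] ends cont by auto
  then have "exterior_pair \<theta> \<psi>"
    using ends unfolding exterior_pair_def by (metis less_irrefl order_less_le)
  moreover from this have "radius \<theta> \<psi> = R"
    using \<psi>(3) by (subst radius_eq_iff) (auto simp: exterior_pair_def e_def)
  ultimately show ?thesis using that by blast
qed

lemma touching_circle_tangent_iff:
  assumes "0 < R"
  shows "\<bar>cross2 (cis s) (touching_center \<theta> R - \<gamma> s)\<bar> = R \<longleftrightarrow>
    cis s = cis \<theta> \<or> height s \<theta> = R * (1 + cos (s - \<theta>))"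
proof -
  have "touching_center \<theta> R - \<gamma> s = (\<gamma> \<theta> - \<gamma> s) - of_real R * (\<i> * cis \<theta>)"
    by (simp add: touching_center_def)
  then have cross: "cross2 (cis s) (touching_center \<theta> R - \<gamma> s) = height s \<theta> - R * cos (s - \<theta>)"
    using cos_minus[of "s - \<theta>"] by (simp add: height_def cross2_linear(2,3) cross2_cis_i_cis)
  show ?thesis
  proof (cases "cis s = cis \<theta>")
    case True
    then have "height s \<theta> = 0" "cos (s - \<theta>) = cos (\<theta> - \<theta>)"
      using height_cong[of s \<theta> \<theta> \<theta>] height_self[of \<theta>]
      by (auto simp: cos_diff complex_eq_iff)
    then show ?thesis unfolding cross using assms True by simp
  next
    case False
    then have "0 < height s \<theta>" using height_pos by metis
    moreover have "0 \<le> R * (1 - cos (s - \<theta>))" using assms by simp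
    ultimately have "height s \<theta> - R * cos (s - \<theta>) \<noteq> - R" by (simp add: algebra_simps)
    then show ?thesis using False assms by (auto simp: cross abs_eq_iff algebra_simps)
  qed
qed

lemma touching_circle_other_tangents:
  assumes "exterior_pair \<phi> \<theta>" "exterior_pair \<theta> \<psi>" "radius \<theta> \<phi> = R" "radius \<theta> \<psi> = R"
  shows "height s \<theta> = R * (1 + cos (s - \<theta>)) \<longleftrightarrow> cis s = cis \<phi> \<or> cis s = cis \<psi>"
proof
  have near: "\<bar>\<phi> - \<theta>\<bar> < pi" "\<bar>\<psi> - \<theta>\<bar> < pi" using assms(1,2) by (auto simp: exterior_pair_def)
  have invariant: "height s \<theta> = height t \<theta>" "cos (s - \<theta>) = cos (t - \<theta>)" if "cis s = cis t" for s t
    using that height_cong[of s t \<theta> \<theta>] by (auto simp: cos_diff complex_eq_iff)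
  show "height s \<theta> = R * (1 + cos (s - \<theta>))" if "cis s = cis \<phi> \<or> cis s = cis \<psi>"
    using that invariant[of s \<phi>] invariant[of s \<psi>] assms(3,4) radius_eq_iff[OF near(1)] radius_eq_iff[OF near(2)]
    by auto
  assume tangent: "height s \<theta> = R * (1 + cos (s - \<theta>))"
  obtain n :: int where n: "\<theta> - pi \<le> s + of_int n * (2 * pi)" "s + of_int n * (2 * pi) < \<theta> - pi + 2 * pi"
    using shift_into_period[of "2 * pi" "\<theta> - pi" s] pi_gt_zero by auto
  define t where "t = s + of_int n * (2 * pi)"
  have t: "\<theta> - pi \<le> t" "t < \<theta> + pi" and cis_t: "cis t = cis s"
    using n by (auto simp: t_def cis_eq_iff_int_multiple)
  have eq: "height t \<theta> = R * (1 + cos (t - \<theta>))" using tangent invariant[OF cis_t] by simp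
  have "0 < R" using radius_pos[OF assms(1)] assms(3) by simp
  then have "t \<noteq> \<theta>" using eq by (auto simp: height_self)
  moreover have "t \<noteq> \<theta> - pi"
  proof
    assume "t = \<theta> - pi"
    moreover from this have "0 < height t \<theta>" by (intro height_pos_near) auto
    ultimately show False using eq by simp
  qed
  ultimately have "\<bar>t - \<theta>\<bar> < pi" and side: "t < \<theta> \<or> \<theta> < t" using t by auto
  then have "radius \<theta> t = R" using eq radius_eq_iff by blast
  then have "t = \<phi> \<or> t = \<psi>"
    using side t \<open>t \<noteq> \<theta> - pi\<close> assms
      inj_onD[OF inj_on_radius(2), of \<theta> t \<phi>] inj_onD[OF inj_on_radius(1), of \<theta> t \<psi>]
    by (auto simp: exterior_pair_def)
  then show "cis s = cis \<phi> \<or> cis s = cis \<psi>" using cis_t by auto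
qed

end

section \<open>The outer length billiard map\<close>

context angle_curve
begin

text \<open>The billiard map takes \<open>vertex \<phi> \<theta>\<close> to \<open>vertex \<theta> \<psi>\<close> when the circle at \<open>\<gamma> \<theta>\<close> is tangent to all three
  tangent lines.\<close>

definition billiard_step :: "real \<Rightarrow> real \<Rightarrow> real \<Rightarrow> bool" where
  "billiard_step \<phi> \<theta> \<psi> \<longleftrightarrow> exterior_pair \<phi> \<theta> \<and> exterior_pair \<theta> \<psi> \<and> radius \<theta> \<psi> = radius \<theta> \<phi>"

lemma ex_billiard_step:
  assumes "exterior_pair \<phi> \<theta>"
  obtains \<psi> where "billiard_step \<phi> \<theta> \<psi>"
  using radius_attained[OF radius_pos[OF assms]] assms unfolding billiard_step_def by metis

end

context oval_chart
begin

lemma positive_multiple_tangent_iff: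
  "(\<exists>k>0. z = of_real k * tangent_vec c t) \<longleftrightarrow> (\<exists>k>0. z = of_real k * cis (\<Theta> t))"
proof -
  define v where "v = cmod (tangent_vec c t)"
  have v: "0 < v" "tangent_vec c t = of_real v * cis (\<Theta> t)"
    using tangent_nonzero tangent_direction by (simp_all add: v_def)
  have "of_real k * cis (\<Theta> t) = of_real (k / v) * tangent_vec c t" for k using v by simp
  moreover have "of_real k * tangent_vec c t = of_real (k * v) * cis (\<Theta> t)" for k using v(2) by simp
  ultimately show ?thesis using v(1) by (metis divide_pos_pos mult_pos_pos)
qed

lemma ex_angle_iff: "(\<exists>t. P (\<Theta> t)) \<longleftrightarrow> (\<exists>s. P s)"
  using surj_angle by (metis surjD)

lemma pos_tangency_vertex:
  assumes "exterior_pair \<phi> \<theta>"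
  shows "pos_tangency c (vertex \<phi> \<theta>) = \<gamma> \<theta>"
proof -
  let ?tangency = "\<lambda>x s. x = \<gamma> s \<and> (\<exists>k>0. \<gamma> s - vertex \<phi> \<theta> = of_real k * cis s)"
  have \<theta>: "\<gamma> \<theta> - vertex \<phi> \<theta> = of_real (len_pos \<phi> \<theta>) * cis \<theta>" by (simp add: vertex_def)
  have "x = \<gamma> \<theta>" if "?tangency x s" for x s
    using that tangency_point_unique[OF _ \<theta>] len_pos_pos[OF assms] by auto
  then have "(THE x. \<exists>s. ?tangency x s) = \<gamma> \<theta>"
    using \<theta> len_pos_pos[OF assms] by (intro the_equality) blast+
  then show ?thesis
    unfolding pos_tangency_def curve_eq positive_multiple_tangent_iff ex_angle_iff[of "?tangency _"] .
qed

lemma neg_tangency_vertex: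
  assumes "exterior_pair \<phi> \<theta>"
  shows "neg_tangency c (vertex \<phi> \<theta>) = \<gamma> \<phi>"
proof -
  let ?tangency = "\<lambda>x s. x = \<gamma> s \<and> (\<exists>k>0. vertex \<phi> \<theta> - \<gamma> s = of_real k * cis s)"
  have \<phi>: "vertex \<phi> \<theta> - \<gamma> \<phi> = of_real (len_neg \<phi> \<theta>) * cis \<phi>" by (simp add: vertex_eq_neg[OF assms])
  have opposite: "\<gamma> s - vertex \<phi> \<theta> = of_real (- k) * cis s" if "vertex \<phi> \<theta> - \<gamma> s = of_real k * cis s" for k s
    using that by (metis minus_diff_eq mult_minus_left of_real_minus)
  have "x = \<gamma> \<phi>" if "?tangency x s" for x s
    using that tangency_point_unique[OF opposite opposite[OF \<phi>]] len_neg_pos[OF assms] by auto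
  then have "(THE x. \<exists>s. ?tangency x s) = \<gamma> \<phi>"
    using \<phi> len_neg_pos[OF assms] by (intro the_equality) blast+
  then show ?thesis
    unfolding neg_tangency_def curve_eq positive_multiple_tangent_iff ex_angle_iff[of "?tangency _"] .
qed

lemma Sigma_circle_vertex:
  assumes "exterior_pair \<phi> \<theta>"
  shows "Sigma_circle c (vertex \<phi> \<theta>) = (touching_center \<theta> (radius \<theta> \<phi>), radius \<theta> \<phi>)"
proof -
  let ?A = "vertex \<phi> \<theta>" and ?R = "radius \<theta> \<phi>"
  note sin = exterior_pair_sin_pos[OF assms] and cos = exterior_pair_cos_pos[OF assms]
    and a = len_pos_pos[OF assms] and p = len_neg_pos[OF assms]
  have P: "\<gamma> \<theta> = ?A + of_real (len_pos \<phi> \<theta>) * cis \<theta>" by (simp add: vertex_def)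
  have sides: "\<gamma> \<theta> - ?A = of_real (len_pos \<phi> \<theta>) * cis \<theta>" "?A - \<gamma> \<phi> = of_real (len_neg \<phi> \<theta>) * cis \<phi>"
    by (simp_all add: P vertex_eq_neg[OF assms])
  have R: "?R * (1 + cos (\<theta> - \<phi>)) = len_pos \<phi> \<theta> * sin (\<theta> - \<phi>)"
    using sin cos cos_minus[of "\<theta> - \<phi>"] by (simp add: radius_def len_pos_def)
  have "touching_center \<theta> ?R - ?A = of_real (len_pos \<phi> \<theta>) * cis \<theta> - of_real ?R * (\<i> * cis \<theta>)"
    by (simp add: touching_center_def P)
  note touching = inscribed_touchingI[OF sin a p R this, folded P]
  have unique: "Z = touching_center \<theta> ?R \<and> r = ?R"
    if "inscribed_in_angle Z r ?A (\<gamma> \<theta> - ?A) (?A - \<gamma> \<phi>)" "\<gamma> \<theta> \<in> sphere Z r" for Z r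
  proof -
    note inscribed = inscribed_touchingD[OF sin a p that(1)[unfolded sides], folded P, OF that(2)]
    have "r = ?R" using inscribed(2) R cos by (metis less_irrefl mult_right_cancel)
    then show ?thesis using inscribed(1) by (simp add: touching_center_def)
  qed
  show ?thesis
    unfolding Sigma_circle_def Let_def pos_tangency_vertex[OF assms] neg_tangency_vertex[OF assms]
  proof (rule the_equality)
    show "case (touching_center \<theta> ?R, ?R) of (Z, r) \<Rightarrow>
        inscribed_in_angle Z r ?A (\<gamma> \<theta> - ?A) (?A - \<gamma> \<phi>) \<and> \<gamma> \<theta> \<in> sphere Z r"
      unfolding prod.case sides using touching by blast
    show "Zr = (touching_center \<theta> ?R, ?R)"
      if "case Zr of (Z, r) \<Rightarrow> inscribed_in_angle Z r ?A (\<gamma> \<theta> - ?A) (?A - \<gamma> \<phi>) \<and> \<gamma> \<theta> \<in> sphere Z r" for Zr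
      using that unique[of "fst Zr" "snd Zr"] unfolding case_prod_beta prod_eq_iff fst_conv snd_conv by blast
  qed
qed

lemma common_tangents_eq:
  assumes "R > 0"
  shows "common_tangents c Z R = {tangent_line s | s. \<bar>cross2 (cis s) (Z - \<gamma> s)\<bar> = R}"
proof -
  have "line (c t) (tangent_vec c t) = tangent_line (\<Theta> t)" for t
  proof -
    have "line (\<gamma> (\<Theta> t)) (of_real (cmod (tangent_vec c t)) * cis (\<Theta> t)) = tangent_line (\<Theta> t)"
      unfolding tangent_line_def using tangent_nonzero
      by (intro line_eq_line_cis) (simp_all add: in_line_cis_iff cross2_def)
    then show ?thesis using tangent_direction[of t] curve_eq[of t] by metis
  qed
  then have lines: "(\<exists>t. l = line (c t) (tangent_vec c t)) \<longleftrightarrow> (\<exists>s. l = tangent_line s)" for l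
    using ex_angle_iff[of "\<lambda>s. l = tangent_line s"] by simp
  have "common_tangents c Z R = {tangent_line s | s. \<exists>!p. p \<in> tangent_line s \<inter> sphere Z R}"
    unfolding common_tangents_def lines by blast
  then show ?thesis unfolding tangent_line_def line_tangent_to_circle_iff[OF assms] .
qed

lemma common_tangents_touching_circle:
  assumes "billiard_step \<phi> \<theta> \<psi>"
  shows "common_tangents c (touching_center \<theta> (radius \<theta> \<phi>)) (radius \<theta> \<phi>)
    = {tangent_line \<theta>, tangent_line \<phi>, tangent_line \<psi>}"
proof -
  have pairs: "exterior_pair \<phi> \<theta>" "exterior_pair \<theta> \<psi>" and radii: "radius \<theta> \<psi> = radius \<theta> \<phi>"
    using assms by (auto simp: billiard_step_def)
  show ?thesis
    unfolding common_tangents_eq[OF radius_pos[OF pairs(1)]] touching_circle_tangent_iff[OF radius_pos[OF pairs(1)]]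
      touching_circle_other_tangents[OF pairs refl radii] tangent_line_eq_iff[symmetric]
    by blast
qed

theorem outer_length_billiard_vertex:
  assumes "billiard_step \<phi> \<theta> \<psi>"
  shows "outer_length_billiard c (vertex \<phi> \<theta>) = vertex \<theta> \<psi>"
proof -
  let ?A = "vertex \<phi> \<theta>"
  have pairs: "exterior_pair \<phi> \<theta>" "exterior_pair \<theta> \<psi>" using assms by (auto simp: billiard_step_def)
  have A: "?A \<in> line (\<gamma> \<phi>) (cis \<phi>)" "?A \<in> line (\<gamma> \<theta>) (cis \<theta>)"
    using tangent_lines_meet[OF pairs(1)] by (auto simp: tangent_line_def)
  have "\<gamma> \<theta> - ?A = of_real (len_pos \<phi> \<theta>) * cis \<theta>" "\<gamma> \<phi> - ?A = of_real (- len_neg \<phi> \<theta>) * cis \<phi>"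
    by (simp add: vertex_def) (simp add: vertex_eq_neg[OF pairs(1)])
  then have sides: "line ?A (\<gamma> \<theta> - ?A) = tangent_line \<theta>" "line ?A (\<gamma> \<phi> - ?A) = tangent_line \<phi>"
    using len_pos_pos[OF pairs(1)] len_neg_pos[OF pairs(1)] line_eq_line_cis[OF A(2)] line_eq_line_cis[OF A(1)]
    by (simp_all only: tangent_line_def neg_equal_0_iff_equal less_imp_neq[symmetric] not_False_eq_True)
  have "cis \<psi> \<noteq> cis \<phi>"
    using cis_inj_near[of \<psi> \<phi>] pairs by (auto simp: exterior_pair_def)
  then have third: "tangent_line \<psi> \<noteq> tangent_line \<theta>" "tangent_line \<psi> \<noteq> tangent_line \<phi>"
    using exterior_pair_cis_neq[OF pairs(2)] by (auto simp: tangent_line_eq_iff)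
  have "B = vertex \<theta> \<psi>"
    if "l \<in> {tangent_line \<theta>, tangent_line \<phi>, tangent_line \<psi>}" "l \<noteq> tangent_line \<theta>" "l \<noteq> tangent_line \<phi>"
      "B \<in> l \<inter> tangent_line \<theta>" for l B
    using that tangent_lines_meet[OF pairs(2)] by blast
  moreover have "vertex \<theta> \<psi> \<in> tangent_line \<psi> \<inter> tangent_line \<theta>"
    using tangent_lines_meet[OF pairs(2)] by blast
  ultimately show ?thesis
    unfolding outer_length_billiard_def Let_def Sigma_circle_vertex[OF pairs(1)] prod.case
      pos_tangency_vertex[OF pairs(1)] neg_tangency_vertex[OF pairs(1)]
      common_tangents_touching_circle[OF assms] sides
    using third by (intro the_equality) blast+
qed

end

section \<open>The flow of the vector field\<close>

lemma one_sided_lipschitz_unique: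
  fixes f g :: "real \<Rightarrow> 'a::real_inner"
  assumes "a \<le> b" and f: "\<And>t. t \<in> {a..b} \<Longrightarrow> (f has_vector_derivative f' t) (at t within {a..b})"
    and g: "\<And>t. t \<in> {a..b} \<Longrightarrow> (g has_vector_derivative g' t) (at t within {a..b})"
    and lipschitz: "\<And>t. t \<in> {a..b} \<Longrightarrow> (f t - g t) \<bullet> (f' t - g' t) \<le> K * ((f t - g t) \<bullet> (f t - g t))"
    and "f a = g a"
  shows "f b = g b"
proof -
  define d where "d = (\<lambda>t. f t - g t)"
  define u where "u = (\<lambda>t. exp (- 2 * K * t) * (d t \<bullet> d t))"
  define u' where "u' = (\<lambda>t. exp (- 2 * K * t) * (2 * (d t \<bullet> (f' t - g' t)) - 2 * K * (d t \<bullet> d t)))"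
  have deriv: "(u has_derivative (\<lambda>h. u' t * h)) (at t within {a..b})" if t: "t \<in> {a..b}" for t
  proof -
    have "(d has_vector_derivative f' t - g' t) (at t within {a..b})"
      unfolding d_def by (intro has_vector_derivative_diff f g t)
    then have "(d has_derivative (\<lambda>h. h *\<^sub>R (f' t - g' t))) (at t within {a..b})"
      by (simp add: has_vector_derivative_def)
    from has_derivative_inner[OF this this]
    have "((\<lambda>t. d t \<bullet> d t) has_real_derivative 2 * (d t \<bullet> (f' t - g' t))) (at t within {a..b})"
      unfolding has_field_derivative_def by (rule has_derivative_eq_rhs) (auto simp: inner_commute)
    moreover have "((\<lambda>t. exp (- 2 * K * t)) has_real_derivative - 2 * K * exp (- 2 * K * t)) (at t within {a..b})"
      by (auto intro!: derivative_eq_intros)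
    ultimately have "(u has_real_derivative u' t) (at t within {a..b})"
      unfolding u_def u'_def by (rule DERIV_cong[OF DERIV_mult[rotated]]) (simp only: algebra_simps)
    then show ?thesis by (simp add: has_field_derivative_def)
  qed
  obtain t where t: "t \<in> {a..b}" and "u b - u a = u' t * (b - a)"
    using mvt_very_simple[OF \<open>a \<le> b\<close> deriv] by auto
  moreover have "u' t \<le> 0"
    unfolding u'_def using lipschitz[OF t] by (intro mult_nonneg_nonpos) (simp_all add: d_def)
  ultimately have "u b \<le> u a" using \<open>a \<le> b\<close> mult_nonpos_nonneg[of "u' t" "b - a"] by simp
  then have "d b \<bullet> d b \<le> 0" using \<open>f a = g a\<close> by (simp add: u_def d_def mult_le_0_iff)
  then have "d b = 0" by (metis inner_eq_zero_iff inner_ge_zero order_antisym)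
  then show ?thesis by (simp add: d_def)
qed

lemma unbounded_of_deriv_ge:
  fixes G g :: "real \<Rightarrow> real"
  assumes G: "\<And>x. (G has_real_derivative g x) (at x)" and ge: "\<And>x. k \<le> g x" and k: "0 < k"
  shows "\<exists>x. G x \<le> y" "\<exists>x. y \<le> G x"
proof -
  have grow: "G a - k * a \<le> G b - k * b" if "a \<le> b" for a b
  proof (rule DERIV_nonneg_imp_nondecreasing[OF that])
    fix x
    have "((\<lambda>x. G x - k * x) has_real_derivative g x - k) (at x)"
      by (auto intro!: derivative_eq_intros G)
    then show "\<exists>y. ((\<lambda>x. G x - k * x) has_real_derivative y) (at x) \<and> 0 \<le> y"
      using ge[of x] by (meson diff_ge_0_iff_ge)
  qed
  define d where "d = \<bar>y - G 0\<bar> / k"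
  have d: "0 \<le> d" "k * d = \<bar>y - G 0\<bar>" using k by (simp_all add: d_def)
  have "G (- d) \<le> y" "y \<le> G d" using grow[of "- d" 0] grow[of 0 d] d by simp_all
  then show "\<exists>x. G x \<le> y" "\<exists>x. y \<le> G x" by blast+
qed

lemma positive_autonomous_ode_solution:
  fixes w :: "real \<Rightarrow> real"
  assumes cont: "continuous_on UNIV w" and w: "\<And>x. 0 < w x" "\<And>x. w x \<le> B"
  obtains \<beta> where "\<beta> 0 = \<alpha>" "\<And>t. (\<beta> has_real_derivative k * w (\<beta> t)) (at t)"
proof -
  have "continuous_on UNIV (\<lambda>x. 1 / w x)"
    using w(1) by (intro continuous_intros cont) (simp add: less_imp_neq[symmetric])
  then obtain G where "\<And>x. (G has_vector_derivative 1 / w x) (at x)"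
    using antiderivative_exists by blast
  then have G: "(G has_real_derivative 1 / w x) (at x)" for x
    by (simp add: has_real_derivative_iff_has_vector_derivative)
  have slope: "1 / B \<le> 1 / w x" "0 < 1 / w x" for x using w[of x] by (simp_all add: frac_le)
  have "0 < 1 / B" using w[of 0] by simp
  then obtain h where h: "\<And>x. h (G x) = x" "\<And>y. (h has_real_derivative 1 / (1 / w (h y))) (at y)"
    using differentiable_inverse_function[OF G slope(2) unbounded_of_deriv_ge[OF G slope(1) \<open>0 < 1 / B\<close>]] by metis
  define \<beta> where "\<beta> = (\<lambda>t. h (G \<alpha> + k * t))"
  have "(\<beta> has_real_derivative k * w (\<beta> t)) (at t)" for t
  proof -
    have "((\<lambda>t. G \<alpha> + k * t) has_real_derivative k) (at t)"
      by (auto intro!: derivative_eq_intros)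
    from DERIV_chain2[OF h(2) this] show ?thesis unfolding \<beta>_def by (simp add: mult.commute)
  qed
  moreover have "\<beta> 0 = \<alpha>" by (simp add: \<beta>_def h)
  ultimately show ?thesis using that by blast
qed

context angle_curve
begin

definition polar_field :: "real \<Rightarrow> complex" where
  "polar_field \<alpha> = - (of_real (2 * breadth \<alpha>) * (\<i> * cis \<alpha>))"

lemma cmod_polar_field: "cmod (polar_field \<alpha>) \<le> 4 * M"
  using breadth_le[of \<alpha>] breadth_pos[of \<alpha>] by (simp add: polar_field_def norm_mult)

lemma polar_field_lipschitz: "cmod (polar_field \<alpha> - polar_field \<beta>) \<le> 8 * M * cmod (cis \<alpha> - cis \<beta>)"
proof -
  have "polar_field \<alpha> - polar_field \<beta> =
      of_real (2 * (breadth \<beta> - breadth \<alpha>)) * (\<i> * cis \<alpha>) + of_real (2 * breadth \<beta>) * (\<i> * (cis \<beta> - cis \<alpha>))"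
    by (simp add: polar_field_def algebra_simps)
  also have "cmod \<dots> \<le> 2 * \<bar>breadth \<beta> - breadth \<alpha>\<bar> + 2 * breadth \<beta> * cmod (cis \<beta> - cis \<alpha>)"
    by (rule order_trans[OF norm_triangle_ineq])
      (simp only: norm_mult norm_of_real norm_ii norm_cis abs_mult abs_numeral abs_of_pos[OF breadth_pos]
        mult_1 mult_1_right order_refl)
  also have "\<dots> \<le> 2 * (2 * M * cmod (cis \<beta> - cis \<alpha>)) + 2 * (2 * M) * cmod (cis \<beta> - cis \<alpha>)"
    using breadth_lipschitz[of \<beta> \<alpha>] breadth_le[of \<beta>]
    by (intro add_mono mult_left_mono mult_right_mono) auto
  finally show ?thesis by (simp add: norm_minus_commute algebra_simps)
qed

end

locale centred_oval = oval_chart +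
  fixes Q :: complex
  assumes centre_in_body: "Q \<in> body"
begin

abbreviation "X \<equiv> field_X c L Q"

lemma field_X_eq_polar_field:
  assumes "p - Q = of_real r * cis \<alpha>" "0 < r"
  shows "X p = polar_field \<alpha>"
proof -
  have r: "cmod (p - Q) = r" using assms by (simp add: norm_mult)
  then have "of_real r * cis (Arg (p - Q)) = of_real r * cis \<alpha>"
    using cmod_cis_Arg[of "p - Q"] assms(1) by simp
  then have breadth: "breadth (Arg (p - Q)) = breadth \<alpha>" using assms(2) by (intro breadth_cong) simp
  then show ?thesis
    unfolding field_X_def width_eq_breadth r breadth polar_field_def unfolding assms(1) using assms(2) by simp
qed

lemma field_X_Arg: "p \<noteq> Q \<Longrightarrow> X p = polar_field (Arg (p - Q))"
  by (rule field_X_eq_polar_field[where r = "cmod (p - Q)"]) (simp_all add: cmod_cis_Arg)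

lemma cmod_field_X: "p \<noteq> Q \<Longrightarrow> cmod (X p) \<le> 4 * M"
  by (simp add: field_X_Arg cmod_polar_field)

lemma field_X_lipschitz:
  assumes "cmod (p - Q) = r" "cmod (q - Q) = r" "r > 0"
  shows "cmod (X p - X q) \<le> 8 * M / r * cmod (p - q)"
proof -
  have "p \<noteq> Q" "q \<noteq> Q" using assms by auto
  then have "cmod (X p - X q) \<le> 8 * M * cmod (cis (Arg (p - Q)) - cis (Arg (q - Q)))"
    by (simp add: field_X_Arg polar_field_lipschitz)
  moreover have "(p - Q) - (q - Q) = of_real r * cis (Arg (p - Q)) - of_real r * cis (Arg (q - Q))"
    using cmod_cis_Arg assms(1,2) by metis
  then have "p - q = of_real r * (cis (Arg (p - Q)) - cis (Arg (q - Q)))" by (simp add: right_diff_distrib)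
  then have "cmod (cis (Arg (p - Q)) - cis (Arg (q - Q))) = cmod (p - q) / r"
    using assms(3) by (simp add: norm_mult)
  ultimately show ?thesis by simp
qed

definition flow_line :: "(real \<Rightarrow> complex) \<Rightarrow> bool" where
  "flow_line f \<longleftrightarrow> (\<forall>t\<in>{0..1}. f t \<noteq> Q \<and> (f has_vector_derivative X (f t)) (at t within {0..1}))"

lemma flow_line_radius:
  assumes "flow_line f" "t \<in> {0..1}"
  shows "cmod (f t - Q) = cmod (f 0 - Q)"
proof -
  have "((\<lambda>t. (f t - Q) \<bullet> (f t - Q)) has_derivative (\<lambda>h. 0)) (at s within {0..1})" if "s \<in> {0..1}" for s
  proof -
    have "(f has_derivative (\<lambda>h. h *\<^sub>R X (f s))) (at s within {0..1})"
      using assms(1) that by (simp add: flow_line_def has_vector_derivative_def)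
    then have "((\<lambda>t. f t - Q) has_derivative (\<lambda>h. h *\<^sub>R X (f s))) (at s within {0..1})"
      by (auto intro!: derivative_eq_intros)
    from has_derivative_inner[OF this this]
    have "((\<lambda>t. (f t - Q) \<bullet> (f t - Q)) has_derivative
        (\<lambda>h. (f s - Q) \<bullet> (h *\<^sub>R X (f s)) + h *\<^sub>R X (f s) \<bullet> (f s - Q))) (at s within {0..1})" .
    moreover have "z \<bullet> (- of_real k * (\<i> * z)) = 0" for z k by (simp add: inner_complex_def)
    then have "(f s - Q) \<bullet> X (f s) = 0" unfolding field_X_def .
    ultimately show ?thesis by (simp add: inner_commute)
  qed
  then have "\<exists>k. \<forall>s\<in>{0..1}. (f s - Q) \<bullet> (f s - Q) = k"
    by (intro has_derivative_zero_constant) auto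
  then have "(f t - Q) \<bullet> (f t - Q) = (f 0 - Q) \<bullet> (f 0 - Q)" using assms(2) by auto
  then show ?thesis by (simp add: norm_eq)
qed

lemma flow_line_unique:
  assumes f: "flow_line f" and g: "flow_line g" and eq: "f 0 = g 0"
  shows "f 1 = g 1"
proof (rule one_sided_lipschitz_unique[OF zero_le_one])
  define r where "r = cmod (f 0 - Q)"
  have "0 < r" using f by (auto simp: flow_line_def r_def)
  show "(f has_vector_derivative X (f t)) (at t within {0..1})"
    "(g has_vector_derivative X (g t)) (at t within {0..1})" if "t \<in> {0..1}" for t
    using f g that by (auto simp: flow_line_def)
  show "(f t - g t) \<bullet> (X (f t) - X (g t)) \<le> 8 * M / r * ((f t - g t) \<bullet> (f t - g t))" if t: "t \<in> {0..1}" for t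
  proof -
    have "(f t - g t) \<bullet> (X (f t) - X (g t)) \<le> cmod (f t - g t) * cmod (X (f t) - X (g t))"
      by (rule norm_cauchy_schwarz)
    also have "\<dots> \<le> cmod (f t - g t) * (8 * M / r * cmod (f t - g t))"
      using flow_line_radius[OF f t] flow_line_radius[OF g t] eq \<open>0 < r\<close>
      by (intro mult_left_mono field_X_lipschitz) (auto simp: r_def)
    finally show ?thesis by (simp add: dot_square_norm power2_eq_square mult_ac)
  qed
qed (rule eq)

lemma flow_line_exists:
  assumes "x \<noteq> Q"
  obtains f where "flow_line f" "f 0 = x"
proof -
  define r where "r = cmod (x - Q)"
  have r: "r > 0" using assms by (simp add: r_def)
  obtain \<beta> where \<beta>: "\<beta> 0 = Arg (x - Q)" "\<And>t. (\<beta> has_real_derivative - 2 / r * breadth (\<beta> t)) (at t)"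
    using positive_autonomous_ode_solution[OF continuous_breadth breadth_pos breadth_le] by blast
  define f where "f = (\<lambda>t. Q + of_real r * cis (\<beta> t))"
  have "f 0 = x" using cmod_cis_Arg[of "x - Q"] by (simp add: f_def \<beta>(1) r_def)
  moreover have "flow_line f"
    unfolding flow_line_def
  proof (intro ballI conjI)
    fix t :: real
    have polar: "f t - Q = of_real r * cis (\<beta> t)" by (simp add: f_def)
    then show "f t \<noteq> Q" using r by auto
    have "((\<lambda>t. cis (\<beta> t)) has_vector_derivative (- 2 / r * breadth (\<beta> t)) *\<^sub>R (\<i> * cis (\<beta> t))) (at t)"
      using has_derivative_cis[OF \<beta>(2)[unfolded has_field_derivative_def]]
      by (simp add: has_vector_derivative_def mult_ac)
    then have "(f has_vector_derivative
        0 + of_real r * ((- 2 / r * breadth (\<beta> t)) *\<^sub>R (\<i> * cis (\<beta> t)))) (at t)"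
      unfolding f_def
      by (intro has_vector_derivative_add has_vector_derivative_const has_vector_derivative_mult_right)
    moreover have "0 + of_real r * ((- 2 / r * breadth (\<beta> t)) *\<^sub>R (\<i> * cis (\<beta> t))) = X (f t)"
      unfolding field_X_eq_polar_field[OF polar r] polar_field_def using r by (simp add: scaleR_conv_of_real)
    ultimately show "(f has_vector_derivative X (f t)) (at t within {0..1})"
      by (auto intro: has_vector_derivative_at_within)
  qed
  ultimately show ?thesis using that by blast
qed

lemma flow_line_displacement:
  assumes "flow_line f" "t \<in> {0..1}"
  shows "cmod (f t - f 0) \<le> 4 * M"
proof -
  have "cmod (f t - f 0) \<le> 4 * M * norm (t - 0)"
  proof (rule differentiable_bound[of "{0..1}" f "\<lambda>t h. h *\<^sub>R X (f t)"])
    show "onorm (\<lambda>h. h *\<^sub>R X (f s)) \<le> 4 * M" if "s \<in> {0..1}" for s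
    proof (rule onorm_le)
      have "cmod (X (f s)) \<le> 4 * M" using assms(1) that by (intro cmod_field_X) (auto simp: flow_line_def)
      then show "norm (h *\<^sub>R X (f s)) \<le> 4 * M * norm h" for h
        by (simp add: mult.commute[of "4 * M"] mult_left_mono)
    qed
  qed (use assms in \<open>auto simp: flow_line_def has_vector_derivative_def\<close>)
  also have "\<dots> \<le> 4 * M * 1" using assms(2) M_pos by (intro mult_left_mono) auto
  finally show ?thesis by simp
qed

theorem time1_flow_displacement:
  assumes "x \<noteq> Q"
  shows "cmod (time1_flow c L Q x - x - X x) \<le> 32 * M\<^sup>2 / cmod (x - Q)"
proof -
  obtain f where f: "flow_line f" and f0: "f 0 = x" using flow_line_exists[OF assms] by blast
  have time1: "time1_flow c L Q x = f 1"
    unfolding time1_flow_def flow_line_def[symmetric]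
    by (rule the_equality) (use f f0 flow_line_unique in metis)+
  have "cmod (f 1 - f 0 - (1 - 0) *\<^sub>R X (f 0)) \<le> norm (1 - 0 :: real) * (32 * M\<^sup>2 / cmod (x - Q))"
  proof (rule vector_differentiable_bound_linearization)
    show "(f has_vector_derivative X (f t)) (at t within {0..1})" if "t \<in> {0..1}" for t
      using f that by (simp add: flow_line_def)
    show "cmod (X (f t) - X (f 0)) \<le> 32 * M\<^sup>2 / cmod (x - Q)" if t: "t \<in> {0..1}" for t
    proof -
      have "cmod (X (f t) - X (f 0)) \<le> 8 * M / cmod (x - Q) * cmod (f t - f 0)"
        using flow_line_radius[OF f t] f0 assms by (intro field_X_lipschitz) auto
      also have "\<dots> \<le> 8 * M / cmod (x - Q) * (4 * M)"
        using flow_line_displacement[OF f t] M_pos by (intro mult_left_mono) auto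
      finally show ?thesis by (simp add: power2_eq_square)
    qed
  qed (auto simp: closed_segment_eq_real_ivl)
  then show ?thesis by (simp add: time1 f0)
qed

end

section \<open>Two steps of the billiard map\<close>

lemma second_order_bound:
  fixes f f' f'' :: "real \<Rightarrow> real"
  assumes f: "\<And>x. (f has_real_derivative f' x) (at x)" and f': "\<And>x. (f' has_real_derivative f'' x) (at x)"
    and B: "\<And>x. \<bar>f'' x\<bar> \<le> B"
  shows "\<bar>f y - (f x + (y - x) * f' x)\<bar> \<le> B * (y - x)\<^sup>2"
proof -
  define F where "F = (\<lambda>i::nat. if i = 0 then f else if i = 1 then f' else f'')"
  have "norm (F 0 y - (\<Sum>i\<le>1. F i x * (y - x) ^ i / fact i)) \<le> B * norm (y - x) ^ Suc 1 / fact 1"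
  proof (rule field_Taylor)
    show "(F i has_real_derivative F (Suc i) z) (at z within UNIV)" if "i \<le> 1" for i z
      using that f f' by (auto simp: F_def)
  qed (use B in \<open>auto simp: F_def\<close>)
  then show ?thesis by (simp add: F_def mult.commute power2_eq_square)
qed

lemma abs_arctan_le: "\<bar>arctan p\<bar> \<le> \<bar>p\<bar>"
  using field_differentiable_bound[of UNIV arctan "\<lambda>x. inverse (1 + x\<^sup>2)" 1 p 0]
  by (auto intro!: DERIV_arctan simp: inverse_le_1_iff)

lemma abs_arctan_diff_le: "\<bar>arctan p - p\<bar> \<le> p\<^sup>2"
proof -
  have deriv2: "((\<lambda>x. inverse (1 + x\<^sup>2)) has_real_derivative - 2 * x / (1 + x\<^sup>2)\<^sup>2) (at x)" for x :: real
    using add_pos_nonneg[of 1 "x\<^sup>2"]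
    by (auto intro!: derivative_eq_intros simp: power2_eq_square divide_simps)
  have "\<bar>- 2 * x / (1 + x\<^sup>2)\<^sup>2\<bar> \<le> 1" for x :: real
  proof -
    have "2 * \<bar>x\<bar> \<le> 1 + x\<^sup>2" using zero_le_power2[of "1 - \<bar>x\<bar>"] by (simp add: power2_diff)
    also have "\<dots> \<le> (1 + x\<^sup>2)\<^sup>2" by (rule self_le_power) simp_all
    finally show ?thesis by (simp add: abs_mult divide_le_eq_1)
  qed
  from second_order_bound[OF DERIV_arctan deriv2 this, of p 0] show ?thesis by simp
qed

lemma second_order_bound_arctan:
  fixes f f' f'' :: "real \<Rightarrow> real"
  assumes f: "\<And>x. (f has_real_derivative f' x) (at x)" and f': "\<And>x. (f' has_real_derivative f'' x) (at x)"
    and B: "\<And>x. \<bar>f'' x\<bar> \<le> B" and D: "\<bar>f' x\<bar> \<le> D"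
  shows "\<bar>f (x + 2 * arctan p) - (f x + 2 * p * f' x)\<bar> \<le> (4 * B + 2 * D) * p\<^sup>2"
proof -
  define h where "h = 2 * arctan p"
  have "0 \<le> B" using B[of 0] by linarith
  have "h\<^sup>2 \<le> (2 * p)\<^sup>2"
    unfolding h_def using abs_arctan_le[of p] by (simp only: power_mult_distrib) (simp add: abs_le_square_iff)
  then have "B * h\<^sup>2 \<le> 4 * B * p\<^sup>2" using mult_left_mono[OF _ \<open>0 \<le> B\<close>] by fastforce
  then have "\<bar>f (x + h) - (f x + h * f' x)\<bar> \<le> 4 * B * p\<^sup>2"
    using second_order_bound[OF f f' B, of "x + h" x] by simp
  moreover have "\<bar>(h - 2 * p) * f' x\<bar> \<le> 2 * p\<^sup>2 * D"
    unfolding abs_mult using abs_arctan_diff_le[of p] D by (intro mult_mono) (auto simp: h_def)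
  moreover have "f (x + h) - (f x + 2 * p * f' x) = (f (x + h) - (f x + h * f' x)) + (h - 2 * p) * f' x"
    by (simp add: algebra_simps)
  ultimately show ?thesis unfolding h_def[symmetric] by (simp add: algebra_simps)
qed

text \<open>The unknown radius \<open>R\<close> is eliminated through \<open>R * (p - q) = d + O(p + q)\<close>, the difference of the two hypotheses.\<close>

lemma sum_of_tangent_lengths:
  fixes p q R w d B :: real
  assumes pq: "0 < p" "0 < q"
    and p: "\<bar>2 * R * p\<^sup>2 - (w + 2 * p * d)\<bar> \<le> B * p\<^sup>2" and q: "\<bar>2 * R * q\<^sup>2 - (w - 2 * q * d)\<bar> \<le> B * q\<^sup>2"
  shows "\<bar>R * (p + q) - (w / q - d)\<bar> \<le> B / 2 * (p + 3 * q)"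
proof -
  define a b s where "a = 2 * R * p\<^sup>2 - (w + 2 * p * d)" and "b = 2 * R * q\<^sup>2 - (w - 2 * q * d)" and "s = p + q"
  have s: "0 < s" using pq by (simp add: s_def)
  have "a - b = (R * (p - q) - d) * (2 * s)"
    by (simp add: a_def b_def s_def power2_eq_square algebra_simps)
  then have "(a - b) / (2 * s) = R * (p - q) - d" using s by simp
  moreover have "b / q = 2 * R * q - w / q + 2 * d"
    using pq by (simp add: b_def field_simps power2_eq_square)
  ultimately have "R * (p + q) - (w / q - d) = (a - b) / (2 * s) + b / q"
    by (simp add: algebra_simps)
  moreover have "\<bar>b / q\<bar> \<le> B * q"
    using q pq by (simp add: b_def power2_eq_square divide_le_eq)
  moreover have "\<bar>(a - b) / (2 * s)\<bar> \<le> B / 2 * s"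
  proof -
    have "0 \<le> B * p\<^sup>2" using p abs_ge_zero order_trans by blast
    then have "0 \<le> B * (p * q)" using pq by (simp add: zero_le_mult_iff)
    then have "B * p\<^sup>2 + B * q\<^sup>2 \<le> B * s * s" by (simp add: s_def power2_eq_square algebra_simps)
    then have "\<bar>a - b\<bar> \<le> B * s * s" using p q unfolding a_def b_def by linarith
    then show ?thesis using s by (simp add: abs_divide divide_le_eq)
  qed
  ultimately have "\<bar>R * (p + q) - (w / q - d)\<bar> \<le> B / 2 * s + B * q" by linarith
  also have "\<dots> = B / 2 * (p + 3 * q)" by (simp add: s_def field_simps)
  finally show ?thesis .
qed

text \<open>The tangent of half the angle under which the curve is seen from \<open>vertex \<phi> \<theta>\<close>.\<close>

definition aperture :: "real \<Rightarrow> real \<Rightarrow> real" where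
  "aperture \<phi> \<theta> = tan ((pi - (\<theta> - \<phi>)) / 2)"

lemma aperture_pos: "exterior_pair \<phi> \<theta> \<Longrightarrow> 0 < aperture \<phi> \<theta>"
  unfolding aperture_def exterior_pair_def by (rule tan_gt_zero) auto

lemma angle_eq_aperture: "exterior_pair \<phi> \<theta> \<Longrightarrow> \<theta> = \<phi> + pi - 2 * arctan (aperture \<phi> \<theta>)"
  unfolding aperture_def exterior_pair_def by (subst arctan_tan) (auto simp: field_simps)

lemma
  assumes "exterior_pair \<phi> \<theta>"
  shows sin_aperture: "sin (\<theta> - \<phi>) = 2 * aperture \<phi> \<theta> / (1 + (aperture \<phi> \<theta>)\<^sup>2)"
    and cos_aperture: "cos (\<theta> - \<phi>) = ((aperture \<phi> \<theta>)\<^sup>2 - 1) / (1 + (aperture \<phi> \<theta>)\<^sup>2)"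
proof -
  define x where "x = (pi - (\<theta> - \<phi>)) / 2"
  have aperture: "aperture \<phi> \<theta> = tan x" by (simp only: aperture_def x_def)
  have angle: "\<theta> - \<phi> = pi - 2 * x" by (simp add: x_def field_simps)
  have "0 < cos x" using assms by (intro cos_gt_zero_pi) (auto simp: x_def exterior_pair_def)
  then have half: "sin (2 * x) = 2 * tan x / (1 + (tan x)\<^sup>2)" "cos (2 * x) = (1 - (tan x)\<^sup>2) / (1 + (tan x)\<^sup>2)"
    by (simp_all only: sin_tan_half cos_tan_half less_imp_neq[symmetric] not_False_eq_True)
  have "sin (pi - 2 * x) = sin (2 * x)" "cos (pi - 2 * x) = - cos (2 * x)" by (simp_all add: sin_diff cos_diff)
  then show "sin (\<theta> - \<phi>) = 2 * aperture \<phi> \<theta> / (1 + (aperture \<phi> \<theta>)\<^sup>2)"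
    "cos (\<theta> - \<phi>) = ((aperture \<phi> \<theta>)\<^sup>2 - 1) / (1 + (aperture \<phi> \<theta>)\<^sup>2)"
    unfolding aperture angle by (simp_all only: half minus_divide_left minus_diff_eq)
qed

context angle_curve
begin

abbreviation "distortion \<equiv> M / m"

lemma distortion_ge_1: "1 \<le> distortion"
  using m_le_M m_pos by simp

lemma height_expansion:
  "\<bar>(1 + p\<^sup>2) * height (\<theta> + pi + 2 * arctan p) \<theta> - (breadth \<theta> + 2 * p * breadth_deriv \<theta>)\<bar> \<le> 14 * M * p\<^sup>2"
proof -
  let ?h = "height (\<theta> + pi + 2 * arctan p) \<theta>"
  have "\<bar>- (height x \<theta> - \<rho> x)\<bar> \<le> 2 * M" for x
    using height_nonneg[of x \<theta>] height_le_2M[of x \<theta>] rho_pos[of x] le_M[of x] M_pos by linarith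
  moreover have "\<bar>- shadow (\<theta> + pi) \<theta>\<bar> \<le> 2 * M" using abs_breadth_deriv_le by (simp add: shadow_opposite)
  ultimately have "\<bar>?h - (height (\<theta> + pi) \<theta> + 2 * p * - shadow (\<theta> + pi) \<theta>)\<bar> \<le> (4 * (2 * M) + 2 * (2 * M)) * p\<^sup>2"
    using second_order_bound_arctan[OF height_base_deriv DERIV_minus[OF shadow_base_deriv]] by blast
  then have "\<bar>?h - (breadth \<theta> + 2 * p * breadth_deriv \<theta>)\<bar> \<le> 12 * M * p\<^sup>2"
    by (simp only: height_opposite shadow_opposite) simp
  moreover have "0 \<le> p\<^sup>2 * ?h" "p\<^sup>2 * ?h \<le> 2 * M * p\<^sup>2"
    using height_nonneg[of "\<theta> + pi + 2 * arctan p" \<theta>]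
      mult_left_mono[OF height_le_2M[of "\<theta> + pi + 2 * arctan p" \<theta>], of "p\<^sup>2"] by (simp_all add: mult_ac)
  ultimately show ?thesis unfolding distrib_right mult_1 by linarith
qed

lemma
  shows breadth_expansion:
    "\<bar>breadth (\<theta> + 2 * arctan p) - (breadth \<theta> + 2 * p * breadth_deriv \<theta>)\<bar> \<le> 12 * M * p\<^sup>2"
  and breadth_deriv_expansion: "\<bar>breadth_deriv (\<theta> + 2 * arctan p) - breadth_deriv \<theta>\<bar> \<le> 4 * M * \<bar>p\<bar>"
proof -
  have bound: "\<bar>\<rho> x + \<rho> (x + pi) - breadth x\<bar> \<le> 2 * M" for x
    using breadth_pos[of x] breadth_le[of x] rho_pos[of x] le_M[of x] rho_pos[of "x + pi"] le_M[of "x + pi"] by linarith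
  from second_order_bound_arctan[OF breadth_has_deriv breadth_deriv_has_deriv this abs_breadth_deriv_le]
  show "\<bar>breadth (\<theta> + 2 * arctan p) - (breadth \<theta> + 2 * p * breadth_deriv \<theta>)\<bar> \<le> 12 * M * p\<^sup>2" by simp
  have "norm (breadth_deriv (\<theta> + 2 * arctan p) - breadth_deriv \<theta>) \<le> 2 * M * norm (\<theta> + 2 * arctan p - \<theta>)"
    by (rule field_differentiable_bound[of UNIV]) (use bound breadth_deriv_has_deriv in auto)
  also have "\<dots> \<le> 2 * M * (2 * \<bar>p\<bar>)" using abs_arctan_le[of p] M_pos by (intro mult_left_mono) auto
  finally show "\<bar>breadth_deriv (\<theta> + 2 * arctan p) - breadth_deriv \<theta>\<bar> \<le> 4 * M * \<bar>p\<bar>" by simp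
qed

lemma
  assumes "exterior_pair \<phi> \<theta>"
  shows len_pos_eq_radius: "len_pos \<phi> \<theta> = radius \<theta> \<phi> * aperture \<phi> \<theta>"
    and len_neg_eq_radius: "len_neg \<phi> \<theta> = radius \<phi> \<theta> * aperture \<phi> \<theta>"
    and radius_height_pos: "2 * radius \<theta> \<phi> * (aperture \<phi> \<theta>)\<^sup>2 = (1 + (aperture \<phi> \<theta>)\<^sup>2) * height \<phi> \<theta>"
    and radius_height_neg: "2 * radius \<phi> \<theta> * (aperture \<phi> \<theta>)\<^sup>2 = (1 + (aperture \<phi> \<theta>)\<^sup>2) * height \<theta> \<phi>"
proof -
  define q where "q = aperture \<phi> \<theta>"
  have q: "0 < q" "0 < 1 + q\<^sup>2" unfolding q_def by (rule aperture_pos[OF assms]) (simp add: add_pos_nonneg)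
  have "1 + cos (\<theta> - \<phi>) = 2 * q\<^sup>2 / (1 + q\<^sup>2)"
    using q(2) by (simp add: cos_aperture[OF assms] q_def[symmetric] field_simps)
  then have radius: "radius \<theta> \<phi> = height \<phi> \<theta> * (1 + q\<^sup>2) / (2 * q\<^sup>2)" "radius \<phi> \<theta> = height \<theta> \<phi> * (1 + q\<^sup>2) / (2 * q\<^sup>2)"
    using cos_minus[of "\<theta> - \<phi>"] by (simp_all add: radius_def)
  then show "2 * radius \<theta> \<phi> * q\<^sup>2 = (1 + q\<^sup>2) * height \<phi> \<theta>" "2 * radius \<phi> \<theta> * q\<^sup>2 = (1 + q\<^sup>2) * height \<theta> \<phi>"
    using q by simp_all
  show "len_pos \<phi> \<theta> = radius \<theta> \<phi> * q" "len_neg \<phi> \<theta> = radius \<phi> \<theta> * q"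
    using q by (simp_all add: len_pos_def len_neg_def sin_aperture[OF assms] radius q_def[symmetric] power2_eq_square)
qed

lemma radius_bounds:
  assumes "exterior_pair \<phi> \<theta>"
  shows "m \<le> radius \<theta> \<phi> * (aperture \<phi> \<theta>)\<^sup>2" "radius \<theta> \<phi> * (aperture \<phi> \<theta>)\<^sup>2 \<le> M"
    "m \<le> radius \<phi> \<theta> * (aperture \<phi> \<theta>)\<^sup>2" "radius \<phi> \<theta> * (aperture \<phi> \<theta>)\<^sup>2 \<le> M"
proof -
  define q where "q = aperture \<phi> \<theta>"
  have q: "0 < 1 + q\<^sup>2" by (simp add: add_pos_nonneg)
  have "(1 + q\<^sup>2) * (1 - cos (\<theta> - \<phi>)) = 2"
    using q by (simp add: cos_aperture[OF assms] q_def[symmetric] field_simps)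
  then have scaled: "(1 + q\<^sup>2) * (k * (1 - cos (\<theta> - \<phi>))) = 2 * k" for k by (simp add: mult.left_commute)
  have "cos (\<phi> - \<theta>) = cos (\<theta> - \<phi>)" using cos_minus[of "\<theta> - \<phi>"] by simp
  then have "2 * m \<le> (1 + q\<^sup>2) * height \<phi> \<theta>" "(1 + q\<^sup>2) * height \<phi> \<theta> \<le> 2 * M"
    "2 * m \<le> (1 + q\<^sup>2) * height \<theta> \<phi>" "(1 + q\<^sup>2) * height \<theta> \<phi> \<le> 2 * M"
    using height_ge[of \<theta> \<phi>] height_le[of \<phi> \<theta>] height_ge[of \<phi> \<theta>] height_le[of \<theta> \<phi>] q
    unfolding scaled[symmetric] by (simp_all add: mult_left_mono del: distrib_right)
  then show "m \<le> radius \<theta> \<phi> * q\<^sup>2" "radius \<theta> \<phi> * q\<^sup>2 \<le> M" "m \<le> radius \<phi> \<theta> * q\<^sup>2" "radius \<phi> \<theta> * q\<^sup>2 \<le> M"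
    using radius_height_pos[OF assms] radius_height_neg[OF assms] by (simp_all add: q_def)
qed

lemma aperture_billiard_step:
  assumes "billiard_step \<phi> \<theta> \<psi>"
  shows "aperture \<phi> \<theta> \<le> distortion * aperture \<theta> \<psi>" "aperture \<theta> \<psi> \<le> distortion * aperture \<phi> \<theta>"
proof -
  have pairs: "exterior_pair \<phi> \<theta>" "exterior_pair \<theta> \<psi>" and radii: "radius \<theta> \<psi> = radius \<theta> \<phi>"
    using assms by (auto simp: billiard_step_def)
  have compare: "x \<le> distortion * y" if "R * x\<^sup>2 \<le> M" "m \<le> R * y\<^sup>2" "0 < R" "0 < y" for R x y
  proof (rule power2_le_imp_le)
    have "m * (R * x\<^sup>2) \<le> m * M" using that(1) m_pos by simp
    also have "\<dots> \<le> M * (R * y\<^sup>2)" using that(2) M_pos by (simp add: mult.commute[of m])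
    finally have "R * x\<^sup>2 \<le> R * (distortion * y\<^sup>2)" using m_pos by (simp add: field_simps)
    then have "x\<^sup>2 \<le> distortion * y\<^sup>2" using that(3) by (rule mult_left_le_imp_le)
    also have "\<dots> \<le> distortion\<^sup>2 * y\<^sup>2"
      using distortion_ge_1 by (intro mult_right_mono self_le_power) auto
    finally show "x\<^sup>2 \<le> (distortion * y)\<^sup>2" by (simp only: power_mult_distrib)
    show "0 \<le> distortion * y" using that(4) m_pos M_pos by simp
  qed
  note bounds = radius_bounds(1,2)[OF pairs(1)] radius_bounds(3,4)[OF pairs(2)]
  show "aperture \<phi> \<theta> \<le> distortion * aperture \<theta> \<psi>" "aperture \<theta> \<psi> \<le> distortion * aperture \<phi> \<theta>"
    using compare bounds aperture_pos[OF pairs(1)] aperture_pos[OF pairs(2)] radius_pos[OF pairs(1)]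
    unfolding radii by blast+
qed

definition step_length :: "real \<Rightarrow> real \<Rightarrow> real \<Rightarrow> real" where
  "step_length \<phi> \<theta> \<psi> = len_pos \<phi> \<theta> + len_neg \<theta> \<psi>"

lemma vertex_step:
  assumes "exterior_pair \<theta> \<psi>"
  shows "vertex \<theta> \<psi> - vertex \<phi> \<theta> = of_real (step_length \<phi> \<theta> \<psi>) * cis \<theta>"
  unfolding vertex_eq_neg[OF assms] by (simp add: vertex_def step_length_def algebra_simps)

lemma step_length_eq:
  assumes "billiard_step \<phi> \<theta> \<psi>"
  shows "step_length \<phi> \<theta> \<psi> = radius \<theta> \<phi> * (aperture \<phi> \<theta> + aperture \<theta> \<psi>)"
  using assms unfolding billiard_step_def step_length_def
  by (simp add: len_pos_eq_radius len_neg_eq_radius distrib_left)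

lemma step_length_expansion:
  assumes step: "billiard_step \<phi> \<theta> \<psi>"
  shows "\<bar>step_length \<phi> \<theta> \<psi> - (breadth \<theta> / aperture \<theta> \<psi> - breadth_deriv \<theta>)\<bar> \<le> 7 * M * (distortion + 3) * aperture \<theta> \<psi>"
    and "\<bar>step_length \<phi> \<theta> \<psi> - (breadth \<theta> / aperture \<phi> \<theta> + breadth_deriv \<theta>)\<bar> \<le> 7 * M * (distortion + 3) * aperture \<phi> \<theta>"
proof -
  define p q R where "p = aperture \<phi> \<theta>" and "q = aperture \<theta> \<psi>" and "R = radius \<theta> \<phi>"
  have pairs: "exterior_pair \<phi> \<theta>" "exterior_pair \<theta> \<psi>" and radii: "radius \<theta> \<psi> = R"
    using step by (auto simp: billiard_step_def R_def)
  have pq: "0 < p" "0 < q" unfolding p_def q_def using aperture_pos pairs by auto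
  have "height (\<theta> + pi + 2 * arctan p) \<theta> = height \<phi> \<theta>"
  proof (rule height_cong)
    show "cis (\<theta> + pi + 2 * arctan p) = cis \<phi>"
      unfolding cis_eq_iff_int_multiple using angle_eq_aperture[OF pairs(1)] by (intro exI[of _ 1]) (simp add: p_def)
  qed simp
  then have p: "\<bar>2 * R * p\<^sup>2 - (breadth \<theta> + 2 * p * breadth_deriv \<theta>)\<bar> \<le> 14 * M * p\<^sup>2"
    using height_expansion[of p \<theta>] radius_height_pos[OF pairs(1)] by (simp add: p_def R_def)
  have "\<theta> + pi + 2 * arctan (- q) = \<psi>"
    using angle_eq_aperture[OF pairs(2)] by (simp add: q_def arctan_minus)
  then have q: "\<bar>2 * R * q\<^sup>2 - (breadth \<theta> - 2 * q * breadth_deriv \<theta>)\<bar> \<le> 14 * M * q\<^sup>2"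
    using height_expansion[of "- q" \<theta>] radius_height_neg[OF pairs(2)] by (simp add: q_def radii)
  have length: "step_length \<phi> \<theta> \<psi> = R * (p + q)" using step_length_eq[OF step] by (simp add: p_def q_def R_def)
  have "14 * M / 2 * (p + 3 * q) \<le> 7 * M * (distortion + 3) * q" "14 * M / 2 * (q + 3 * p) \<le> 7 * M * (distortion + 3) * p"
    using mult_left_mono[OF aperture_billiard_step(1)[OF step], of "7 * M"]
      mult_left_mono[OF aperture_billiard_step(2)[OF step], of "7 * M"] M_pos
    by (simp_all add: p_def q_def algebra_simps)
  moreover have "\<bar>R * (q + p) - (breadth \<theta> / p - - breadth_deriv \<theta>)\<bar> \<le> 14 * M / 2 * (q + 3 * p)"
    using p q by (intro sum_of_tangent_lengths[OF pq(2,1)]) simp_all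
  ultimately show "\<bar>step_length \<phi> \<theta> \<psi> - (breadth \<theta> / q - breadth_deriv \<theta>)\<bar> \<le> 7 * M * (distortion + 3) * q"
    "\<bar>step_length \<phi> \<theta> \<psi> - (breadth \<theta> / p + breadth_deriv \<theta>)\<bar> \<le> 7 * M * (distortion + 3) * p"
    using sum_of_tangent_lengths[OF pq p q] by (simp_all add: length add.commute)
qed

lemma step_length_bounds:
  assumes "billiard_step \<phi> \<theta> \<psi>"
  shows "0 < step_length \<phi> \<theta> \<psi>"
    "step_length \<phi> \<theta> \<psi> * aperture \<phi> \<theta> \<le> M * (1 + distortion)" "step_length \<phi> \<theta> \<psi> * aperture \<theta> \<psi> \<le> M * (1 + distortion)"
proof -
  define p q R where "p = aperture \<phi> \<theta>" and "q = aperture \<theta> \<psi>" and "R = radius \<theta> \<phi>"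
  have pairs: "exterior_pair \<phi> \<theta>" "exterior_pair \<theta> \<psi>" and radii: "radius \<theta> \<psi> = R"
    using assms by (auto simp: billiard_step_def R_def)
  have pos: "0 < p" "0 < q" "0 < R" unfolding p_def q_def R_def using aperture_pos radius_pos pairs by auto
  have length: "step_length \<phi> \<theta> \<psi> = R * (p + q)" using step_length_eq[OF assms] by (simp add: p_def q_def R_def)
  show "0 < step_length \<phi> \<theta> \<psi>" using pos by (simp add: length)
  have scaled: "R * (x + y) * x \<le> M * (1 + distortion)" if "R * x\<^sup>2 \<le> M" "y \<le> distortion * x" "0 < x" for x y
  proof -
    have "R * (x + y) * x \<le> R * (x + distortion * x) * x"
      using that pos(3) by (intro mult_left_mono mult_right_mono) auto
    also have "\<dots> = R * x\<^sup>2 * (1 + distortion)" by (simp add: power2_eq_square algebra_simps)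
    also have "\<dots> \<le> M * (1 + distortion)" using that(1) distortion_ge_1 by (intro mult_right_mono) auto
    finally show ?thesis .
  qed
  show "step_length \<phi> \<theta> \<psi> * p \<le> M * (1 + distortion)"
    using scaled[of p q] radius_bounds(2)[OF pairs(1)] aperture_billiard_step(2)[OF assms] pos by (simp add: length p_def q_def R_def)
  show "step_length \<phi> \<theta> \<psi> * q \<le> M * (1 + distortion)"
    using scaled[of q p] radius_bounds(4)[OF pairs(2)] aperture_billiard_step(1)[OF assms] pos
    by (simp add: length p_def q_def radii add.commute)
qed

lemma consecutive_step_lengths:
  assumes step1: "billiard_step \<phi> \<theta> \<psi>" and step2: "billiard_step \<theta> \<psi> \<omega>"
  shows "\<bar>step_length \<theta> \<psi> \<omega> - step_length \<phi> \<theta> \<psi>\<bar> \<le> M * (14 * distortion + 58) * aperture \<theta> \<psi>"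
proof -
  define q where "q = aperture \<theta> \<psi>"
  have pair: "exterior_pair \<theta> \<psi>" using step1 by (simp add: billiard_step_def)
  have q: "0 < q" unfolding q_def using pair by (rule aperture_pos)
  have "\<psi> = (\<theta> + 2 * arctan (- q)) + pi"
    using angle_eq_aperture[OF pair] by (simp add: q_def arctan_minus)
  then have \<psi>: "breadth \<psi> = breadth (\<theta> + 2 * arctan (- q))" "breadth_deriv \<psi> = breadth_deriv (\<theta> + 2 * arctan (- q))"
    by (simp_all only: breadth_plus_pi breadth_deriv_plus_pi)
  have increment: "(breadth \<psi> / q + breadth_deriv \<psi>) - (breadth \<theta> / q - breadth_deriv \<theta>)
      = (breadth \<psi> - (breadth \<theta> + 2 * - q * breadth_deriv \<theta>)) / q + (breadth_deriv \<psi> - breadth_deriv \<theta>)"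
    using q by (simp add: field_simps)
  have "\<bar>(breadth \<psi> - (breadth \<theta> + 2 * - q * breadth_deriv \<theta>)) / q\<bar> \<le> 12 * M * q"
    using breadth_expansion[of \<theta> "- q"] q by (simp add: \<psi> divide_le_eq power2_eq_square)
  moreover have "\<bar>breadth_deriv \<psi> - breadth_deriv \<theta>\<bar> \<le> 4 * M * q"
    using breadth_deriv_expansion[of \<theta> "- q"] q by (simp add: \<psi>)
  ultimately have "\<bar>(breadth \<psi> / q + breadth_deriv \<psi>) - (breadth \<theta> / q - breadth_deriv \<theta>)\<bar> \<le> 12 * M * q + 4 * M * q"
    unfolding increment by (intro order_trans[OF abs_triangle_ineq] add_mono)
  then have "\<bar>step_length \<theta> \<psi> \<omega> - step_length \<phi> \<theta> \<psi>\<bar> \<le> 2 * (7 * M * (distortion + 3) * q) + 16 * M * q"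
    using step_length_expansion(1)[OF step1] step_length_expansion(2)[OF step2] unfolding q_def by linarith
  then show ?thesis by (simp add: q_def algebra_simps)
qed

lemma one_minus_cis_arctan: "1 - cis (- 2 * arctan q) = 2 * \<i> * of_real q / (1 + \<i> * of_real q)"
proof -
  have q: "0 < 1 + q\<^sup>2" by (simp add: add_pos_nonneg)
  have "1 - cis (- 2 * arctan q) = of_real (2 * q / (1 + q\<^sup>2)) * Complex q 1"
    using cos_tan_half[of "arctan q"] sin_tan_half[of "arctan q"] q
    by (simp add: complex_eq_iff tan_arctan field_simps power2_eq_square)
  also have "\<dots> * (1 + \<i> * of_real q) = of_real (2 * q / (1 + q\<^sup>2)) * (\<i> * of_real (1 + q\<^sup>2))"
    by (simp add: complex_eq_iff power2_eq_square algebra_simps)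
  also have "\<dots> = 2 * \<i> * of_real q" using q by (simp add: complex_eq_iff)
  finally have "(1 - cis (- 2 * arctan q)) * (1 + \<i> * of_real q) = 2 * \<i> * of_real q" .
  moreover have "1 + \<i> * of_real q \<noteq> 0" by (simp add: complex_eq_iff)
  ultimately show ?thesis by (simp only: eq_divide_eq if_False if_True not_False_eq_True)
qed

text \<open>With \<open>l\<close> and \<open>l'\<close> the lengths of the two steps the displacement is \<open>l * cis \<theta> + l' * cis \<psi>\<close>, where \<open>l' - l\<close> is
  small and \<open>cis \<psi> = - cis (\<theta> - 2 * arctan q)\<close>.\<close>

lemma two_step_displacement_decomposition:
  assumes step1: "billiard_step \<phi> \<theta> \<psi>" and step2: "billiard_step \<theta> \<psi> \<omega>"
  defines "q \<equiv> aperture \<theta> \<psi>"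
  shows "vertex \<psi> \<omega> - vertex \<phi> \<theta> - polar_field (\<theta> + pi) =
    of_real (step_length \<theta> \<psi> \<omega> - step_length \<phi> \<theta> \<psi>) * cis \<psi>
    + 2 * \<i> * cis \<theta> * (of_real (step_length \<phi> \<theta> \<psi> * q) / (1 + \<i> * of_real q) - of_real (breadth \<theta>))"
proof -
  have pairs: "exterior_pair \<theta> \<psi>" "exterior_pair \<psi> \<omega>"
    using step1 step2 by (auto simp: billiard_step_def)
  define l l' where "l = step_length \<phi> \<theta> \<psi>" and "l' = step_length \<theta> \<psi> \<omega>"
  have "\<psi> = (\<theta> + - 2 * arctan q) + pi"
    using angle_eq_aperture[OF pairs(1)] by (simp add: q_def)
  then have "cis \<psi> = - (cis \<theta> * cis (- 2 * arctan q))" by (simp only: cis_plus_pi cis_mult)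
  then have chord: "cis \<theta> + cis \<psi> = cis \<theta> * (2 * \<i> * of_real q / (1 + \<i> * of_real q))"
    unfolding one_minus_cis_arctan[symmetric] by (simp add: algebra_simps)
  have "vertex \<psi> \<omega> - vertex \<phi> \<theta> = of_real l * cis \<theta> + of_real l' * cis \<psi>"
    unfolding l_def l'_def vertex_step[OF pairs(1), symmetric] vertex_step[OF pairs(2), symmetric] by simp
  moreover have "polar_field (\<theta> + pi) = 2 * \<i> * cis \<theta> * of_real (breadth \<theta>)"
    by (simp add: polar_field_def breadth_plus_pi cis_plus_pi)
  ultimately have "vertex \<psi> \<omega> - vertex \<phi> \<theta> - polar_field (\<theta> + pi)
      = of_real (l' - l) * cis \<psi> + of_real l * (cis \<theta> + cis \<psi>) - 2 * \<i> * cis \<theta> * of_real (breadth \<theta>)"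
    by (simp add: algebra_simps)
  also have "\<dots> = of_real (l' - l) * cis \<psi>
      + 2 * \<i> * cis \<theta> * (of_real (l * q) / (1 + \<i> * of_real q) - of_real (breadth \<theta>))"
    unfolding chord by (simp add: right_diff_distrib mult_ac)
  finally show ?thesis unfolding l_def l'_def .
qed

lemma two_step_displacement_near:
  assumes step1: "billiard_step \<phi> \<theta> \<psi>" and step2: "billiard_step \<theta> \<psi> \<omega>" and near: "1 \<le> aperture \<theta> \<psi>"
  shows "cmod (vertex \<psi> \<omega> - vertex \<phi> \<theta> - polar_field (\<theta> + pi)) \<le> M * (28 * distortion + 108)"
proof -
  have pairs: "exterior_pair \<theta> \<psi>" "exterior_pair \<psi> \<omega>"
    using step1 step2 by (auto simp: billiard_step_def)
  have shorten: "\<bar>l\<bar> \<le> B" if "0 < l" "l * aperture \<theta> \<psi> \<le> B" for l B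
  proof -
    have "l * 1 \<le> l * aperture \<theta> \<psi>" using near that(1) by (intro mult_left_mono) auto
    then show ?thesis using that by linarith
  qed
  note lengths = shorten[OF step_length_bounds(1,3)[OF step1]] shorten[OF step_length_bounds(1,2)[OF step2]]
  have "vertex \<psi> \<omega> - vertex \<phi> \<theta> - polar_field (\<theta> + pi)
      = of_real (step_length \<theta> \<psi> \<omega>) * cis \<psi> + of_real (step_length \<phi> \<theta> \<psi>) * cis \<theta> - polar_field (\<theta> + pi)"
    unfolding vertex_step[OF pairs(1), symmetric] vertex_step[OF pairs(2), symmetric] by simp
  also have "cmod \<dots> \<le> M * (1 + distortion) + M * (1 + distortion) + 4 * M"
    by (intro order_trans[OF norm_triangle_ineq4] order_trans[OF norm_triangle_ineq] add_mono cmod_polar_field)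
      (use lengths in \<open>simp_all add: norm_mult\<close>)
  also have "\<dots> = M * (2 * distortion + 6)" by (simp add: algebra_simps)
  also have "\<dots> \<le> M * (28 * distortion + 108)"
    using M_pos distortion_ge_1 by (intro mult_left_mono) auto
  finally show ?thesis .
qed

lemma cmod_div_one_plus_i_le:
  assumes "0 \<le> q" "0 \<le> w"
  shows "cmod (of_real x / (1 + \<i> * of_real q) - of_real w) \<le> \<bar>x - w\<bar> + w * q"
proof -
  have one: "1 \<le> cmod (1 + \<i> * of_real q)" by (rule order_trans[OF _ complex_Re_le_cmod]) simp
  then have "of_real x / (1 + \<i> * of_real q) - of_real w
      = (of_real (x - w) - \<i> * of_real (w * q)) / (1 + \<i> * of_real q)"
    by (subst divide_diff_eq_iff) (auto simp: algebra_simps)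
  also have "cmod \<dots> \<le> cmod (of_real (x - w) - \<i> * of_real (w * q))"
    unfolding norm_divide using one by (simp add: divide_le_eq mult_le_cancel_left1)
  also have "\<dots> \<le> \<bar>x - w\<bar> + w * q"
    by (rule order_trans[OF norm_triangle_ineq4])
      (use assms in \<open>simp add: norm_mult flip: of_real_diff of_real_mult\<close>)
  finally show ?thesis .
qed

lemma step_length_times_aperture:
  assumes step: "billiard_step \<phi> \<theta> \<psi>" and far: "aperture \<theta> \<psi> \<le> 1"
  shows "\<bar>step_length \<phi> \<theta> \<psi> * aperture \<theta> \<psi> - breadth \<theta>\<bar> \<le> M * (7 * distortion + 23) * aperture \<theta> \<psi>"
proof -
  define q l e where "q = aperture \<theta> \<psi>" and "l = step_length \<phi> \<theta> \<psi>"
    and "e = l - (breadth \<theta> / q - breadth_deriv \<theta>)"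
  have q: "0 < q" "q \<le> 1" using far step aperture_pos by (auto simp: q_def billiard_step_def)
  have "\<bar>q * e\<bar> \<le> 1 * \<bar>e\<bar>" unfolding abs_mult using q by (intro mult_right_mono) auto
  also have "\<dots> \<le> 7 * M * (distortion + 3) * q"
    using step_length_expansion(1)[OF step] by (simp add: e_def q_def l_def)
  finally have "\<bar>q * e\<bar> \<le> 7 * M * (distortion + 3) * q" .
  moreover have "\<bar>q * breadth_deriv \<theta>\<bar> \<le> q * (2 * M)"
    unfolding abs_mult using q abs_breadth_deriv_le by (intro mult_mono) auto
  moreover have "l * q - breadth \<theta> = q * e - q * breadth_deriv \<theta>"
    using q by (simp add: e_def field_simps)
  ultimately have "\<bar>l * q - breadth \<theta>\<bar> \<le> M * (7 * distortion + 23) * q" by (simp add: algebra_simps)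
  then show ?thesis by (simp only: l_def q_def)
qed

lemma two_step_displacement_far:
  assumes step1: "billiard_step \<phi> \<theta> \<psi>" and step2: "billiard_step \<theta> \<psi> \<omega>" and far: "aperture \<theta> \<psi> \<le> 1"
  shows "cmod (vertex \<psi> \<omega> - vertex \<phi> \<theta> - polar_field (\<theta> + pi)) \<le> M * (28 * distortion + 108) * aperture \<theta> \<psi>"
proof -
  define q l w where "q = aperture \<theta> \<psi>" and "l = step_length \<phi> \<theta> \<psi>" and "w = breadth \<theta>"
  have q: "0 < q" using step1 aperture_pos by (auto simp: q_def billiard_step_def)
  have "cmod (of_real (l * q) / (1 + \<i> * of_real q) - of_real w) \<le> \<bar>l * q - w\<bar> + w * q"
    using q breadth_pos[of \<theta>] by (intro cmod_div_one_plus_i_le) (simp_all add: w_def)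
  also have "\<dots> \<le> M * (7 * distortion + 23) * q + 2 * M * q"
    using step_length_times_aperture[OF step1 far] q breadth_le[of \<theta>]
    by (intro add_mono mult_right_mono) (simp_all only: l_def q_def w_def less_imp_le)
  also have "\<dots> = M * (7 * distortion + 25) * q" by (simp add: algebra_simps)
  finally have "cmod (of_real (l * q) / (1 + \<i> * of_real q) - of_real w) \<le> M * (7 * distortion + 25) * q" .
  then have "cmod (2 * \<i> * cis \<theta> * (of_real (l * q) / (1 + \<i> * of_real q) - of_real w)) \<le> 2 * (M * (7 * distortion + 25) * q)"
    by (simp add: norm_mult)
  moreover have "cmod (of_real (step_length \<theta> \<psi> \<omega> - l) * cis \<psi>) \<le> M * (14 * distortion + 58) * q"
    using consecutive_step_lengths[OF step1 step2] unfolding norm_mult norm_of_real by (simp add: l_def q_def)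
  ultimately have "cmod (vertex \<psi> \<omega> - vertex \<phi> \<theta> - polar_field (\<theta> + pi))
      \<le> M * (14 * distortion + 58) * q + 2 * (M * (7 * distortion + 25) * q)"
    unfolding two_step_displacement_decomposition[OF step1 step2] q_def[symmetric] l_def[symmetric] w_def[symmetric]
    by (intro order_trans[OF norm_triangle_ineq] add_mono)
  then show ?thesis by (simp add: q_def algebra_simps)
qed

lemma two_step_displacement:
  assumes "billiard_step \<phi> \<theta> \<psi>" "billiard_step \<theta> \<psi> \<omega>"
  shows "cmod (vertex \<psi> \<omega> - vertex \<phi> \<theta> - polar_field (\<theta> + pi))
    \<le> M * (28 * distortion + 108) * min 1 (aperture \<theta> \<psi>)"
  using two_step_displacement_near[OF assms] two_step_displacement_far[OF assms] by (auto simp: min_def)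

end

context centred_oval
begin

lemma vertex_minus_centre: "vertex \<phi> \<theta> - Q = (\<gamma> \<theta> - Q) - of_real (len_pos \<phi> \<theta>) * cis \<theta>"
  by (simp add: vertex_def)

lemma cmod_gamma_minus_centre: "cmod (\<gamma> s - Q) \<le> 2 * M"
  by (rule cmod_body_diff[OF centre_in_body])

lemma vertex_distance_aperture:
  assumes step: "billiard_step \<phi> \<theta> \<psi>"
  shows "cmod (vertex \<phi> \<theta> - Q) * min 1 (aperture \<theta> \<psi>) \<le> M * (distortion + 2)"
proof -
  define p q where "p = aperture \<phi> \<theta>" and "q = aperture \<theta> \<psi>"
  have pair: "exterior_pair \<phi> \<theta>" "exterior_pair \<theta> \<psi>" using step by (auto simp: billiard_step_def)
  have pq: "0 < p" "0 < q" unfolding p_def q_def using aperture_pos pair by auto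
  have "0 < len_pos \<phi> \<theta>" by (rule len_pos_pos[OF pair(1)])
  have "cmod (vertex \<phi> \<theta> - Q) \<le> 2 * M + len_pos \<phi> \<theta>"
    using norm_triangle_ineq4[of "\<gamma> \<theta> - Q" "of_real (len_pos \<phi> \<theta>) * cis \<theta>"]
      \<open>0 < len_pos \<phi> \<theta>\<close> cmod_gamma_minus_centre[of \<theta>]
    by (simp add: vertex_minus_centre norm_mult)
  then have "cmod (vertex \<phi> \<theta> - Q) * min 1 q \<le> (2 * M + len_pos \<phi> \<theta>) * min 1 q"
    using pq by (intro mult_right_mono) auto
  also have "\<dots> \<le> 2 * M * 1 + len_pos \<phi> \<theta> * q"
    unfolding distrib_right using M_pos \<open>0 < len_pos \<phi> \<theta>\<close> by (intro add_mono mult_left_mono) auto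
  also have "len_pos \<phi> \<theta> * q \<le> len_pos \<phi> \<theta> * (distortion * p)"
    using aperture_billiard_step(2)[OF step] \<open>0 < len_pos \<phi> \<theta>\<close> by (intro mult_left_mono) (auto simp: p_def q_def)
  also have "\<dots> = distortion * (radius \<theta> \<phi> * p\<^sup>2)"
    by (simp add: len_pos_eq_radius[OF pair(1)] p_def power2_eq_square)
  also have "\<dots> \<le> distortion * M"
    using radius_bounds(2)[OF pair(1)] distortion_ge_1 by (intro mult_left_mono) (auto simp: p_def)
  finally show ?thesis by (simp add: q_def algebra_simps)
qed

lemma polar_field_at_vertex:
  assumes pair: "exterior_pair \<phi> \<theta>" and neq: "vertex \<phi> \<theta> \<noteq> Q"
  shows "cmod (polar_field (\<theta> + pi) - X (vertex \<phi> \<theta>)) \<le> 32 * M\<^sup>2 / cmod (vertex \<phi> \<theta> - Q)"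
proof -
  define r a \<alpha> where "r = cmod (vertex \<phi> \<theta> - Q)" and "a = len_pos \<phi> \<theta>" and "\<alpha> = Arg (vertex \<phi> \<theta> - Q)"
  have r: "0 < r" using neq by (simp add: r_def)
  have a: "cmod (of_real a * cis \<theta>) = a" using len_pos_pos[OF pair] by (simp add: norm_mult a_def)
  have polar: "of_real r * cis \<alpha> = (\<gamma> \<theta> - Q) - of_real a * cis \<theta>"
    unfolding r_def \<alpha>_def a_def cmod_cis_Arg by (rule vertex_minus_centre)
  have "(vertex \<phi> \<theta> - Q) - - (of_real a * cis \<theta>) = \<gamma> \<theta> - Q" by (simp add: a_def vertex_def)
  then have "\<bar>r - a\<bar> \<le> 2 * M"
    using norm_triangle_ineq3[of "vertex \<phi> \<theta> - Q" "- (of_real a * cis \<theta>)"] cmod_gamma_minus_centre[of \<theta>]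
    by (simp only: norm_minus_cancel a r_def)
  moreover have "of_real r * (cis (\<theta> + pi) - cis \<alpha>) = - (of_real (r - a) * cis \<theta>) - (\<gamma> \<theta> - Q)"
    using polar unfolding cis_plus_pi by (simp add: algebra_simps)
  then have "r * cmod (cis (\<theta> + pi) - cis \<alpha>) \<le> \<bar>r - a\<bar> + cmod (\<gamma> \<theta> - Q)"
    using r norm_triangle_ineq4[of "- (of_real (r - a) * cis \<theta>)" "\<gamma> \<theta> - Q"]
    by (metis norm_mult norm_minus_cancel norm_of_real norm_cis mult_1_right abs_of_pos)
  ultimately have "cmod (cis (\<theta> + pi) - cis \<alpha>) \<le> 4 * M / r"
    using cmod_gamma_minus_centre[of \<theta>] r by (simp add: pos_le_divide_eq mult.commute)
  then have "8 * M * cmod (cis (\<theta> + pi) - cis \<alpha>) \<le> 8 * M * (4 * M / r)"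
    using M_pos by (intro mult_left_mono) auto
  then have "cmod (polar_field (\<theta> + pi) - polar_field \<alpha>) \<le> 32 * M\<^sup>2 / r"
    using polar_field_lipschitz[of "\<theta> + pi" \<alpha>] by (simp add: power2_eq_square)
  then show ?thesis using field_X_Arg[OF neq] by (simp add: r_def \<alpha>_def)
qed

theorem billiard_twice_displacement:
  assumes "x \<notin> body"
  shows "cmod ((outer_length_billiard c ^^ 2) x - x - X x)
    \<le> (M\<^sup>2 * (28 * distortion + 108) * (distortion + 2) + 32 * M\<^sup>2) / cmod (x - Q)"
proof -
  obtain \<phi> \<theta> where pair: "exterior_pair \<phi> \<theta>" and x: "x = vertex \<phi> \<theta>"
    using exterior_point_is_vertex[OF assms] by blast
  obtain \<psi> where step1: "billiard_step \<phi> \<theta> \<psi>" using ex_billiard_step[OF pair] by blast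
  then obtain \<omega> where step2: "billiard_step \<theta> \<psi> \<omega>"
    using ex_billiard_step unfolding billiard_step_def by metis
  have image: "(outer_length_billiard c ^^ 2) x = vertex \<psi> \<omega>"
    by (simp add: x numeral_2_eq_2 outer_length_billiard_vertex[OF step1] outer_length_billiard_vertex[OF step2])
  have "x \<noteq> Q" using assms centre_in_body by blast
  then have r: "0 < cmod (x - Q)" by simp
  define K where "K = M * (28 * distortion + 108)"
  have "0 \<le> K" using M_pos distortion_ge_1 by (simp add: K_def)
  have "K * min 1 (aperture \<theta> \<psi>) \<le> K * (M * (distortion + 2) / cmod (x - Q))"
    using vertex_distance_aperture[OF step1] r \<open>0 \<le> K\<close>
    by (intro mult_left_mono) (simp_all add: x pos_le_divide_eq mult.commute)
  then have "cmod (vertex \<psi> \<omega> - x - polar_field (\<theta> + pi)) \<le> K * (M * (distortion + 2) / cmod (x - Q))"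
    using two_step_displacement[OF step1 step2] unfolding x K_def by linarith
  moreover have "cmod (polar_field (\<theta> + pi) - X x) \<le> 32 * M\<^sup>2 / cmod (x - Q)"
    using polar_field_at_vertex[OF pair] \<open>x \<noteq> Q\<close> unfolding x by blast
  ultimately have "cmod (vertex \<psi> \<omega> - x - X x)
      \<le> K * (M * (distortion + 2) / cmod (x - Q)) + 32 * M\<^sup>2 / cmod (x - Q)"
    by (rule norm_diff_triangle_le)
  also have "\<dots> = (M\<^sup>2 * (28 * distortion + 108) * (distortion + 2) + 32 * M\<^sup>2) / cmod (x - Q)"
    by (simp add: K_def power2_eq_square add_divide_distrib mult_ac)
  finally show ?thesis unfolding image .
qed

end

theorem theorem4p1:
  fixes c :: "real \<Rightarrow> complex" and L :: real and Q :: complex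
  assumes "oval c L"
    and "Q \<in> interior (oval_domain c L)"
  shows "\<exists>C::real. \<forall>x. x \<notin> oval_domain c L \<longrightarrow>
           cmod ((outer_length_billiard c ^^ 2) x - time1_flow c L Q x) \<le> C / cmod (x - Q)"
proof -
  obtain \<gamma> \<rho> m M \<Theta> where "oval_chart \<gamma> \<rho> m M c L \<Theta>" using oval_has_chart[OF assms(1)] .
  then interpret oval_chart \<gamma> \<rho> m M c L \<Theta> .
  interpret centred_oval \<gamma> \<rho> m M c L \<Theta> Q
    using assms(2) interior_subset by unfold_locales (auto simp: domain_eq)
  define B where "B = M\<^sup>2 * (28 * distortion + 108) * (distortion + 2) + 32 * M\<^sup>2"
  have "cmod ((outer_length_billiard c ^^ 2) x - time1_flow c L Q x) \<le> (B + 32 * M\<^sup>2) / cmod (x - Q)"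
    if "x \<notin> oval_domain c L" for x
  proof -
    have "x \<noteq> Q" using that centre_in_body domain_eq by blast
    have "cmod ((outer_length_billiard c ^^ 2) x - x - X x) \<le> B / cmod (x - Q)"
      using billiard_twice_displacement that by (simp add: B_def domain_eq)
    moreover have "cmod (time1_flow c L Q x - x - X x) \<le> 32 * M\<^sup>2 / cmod (x - Q)"
      by (rule time1_flow_displacement[OF \<open>x \<noteq> Q\<close>])
    ultimately show ?thesis
      using norm_triangle_ineq4[of "(outer_length_billiard c ^^ 2) x - x - X x" "time1_flow c L Q x - x - X x"]
      by (simp add: add_divide_distrib)
  qed
  then show ?thesis by blast
qed

end
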